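(* Let $K_1, K_2$ be two oriented Legendrian knots in $(\mathbb{R}^3,\xi_{std})$ whose fundamental GL-racks $GLR_{K_1}$ and $GLR_{K_2}$ are isomorphic as GL-racks. Then either $tb(K_1)=tb(K_2)$ and $rot(K_1)=rot(K_2)$, or $tb(K_1)=-tb(K_2)$ and $rot(K_1)=-rot(K_2)$.
   Context: **Legendrian knots and fronts.** $\mathbb{R}^3$ with coordinates $(x,y,z)$ carries the standard contact structure $\xi_{std}=\ker(dz-y\,dx)$. A Legendrian knot is a smoothly embedded circle in $\mathbb{R}^3$ everywhere tangent to $\xi_{std}$; knots are oriented. The front projection is $(x,y,z)\mapsto(x,z)$. A (generic) front diagram $D(K)$ has no vertical tangencies; it has finitely many semicubical cusps (left and right) and finitely many transverse double points (crossings), and at each crossing the overcrossing strand is the one with the more negative slope (this is forced by $y=dz/dx$). A cusp is an up cusp (resp. down cusp) if the knot traverses it upwards (resp. downwards) in the $z$-direction, following the orientation. **Classical invariants.** Let $w(D(K))$ be the writhe (sum of the signs of the crossings), and let $D$ and $U$ be the numbers of down cusps and up cusps of $D(K)$. Then $tb(K)=w(D(K))-\frac12(D+U)$ (Thurston-Bennequin number) and $rot(K)=\frac12(D-U)$ (rotation number). Both are independent of the choice of front diagram of $K$. **GL-racks.** A rack is a set $X$ with a binary operation $\ast$ such that for every $x\in X$ the map $y\mapsto y\ast x$ is a bijection of $X$ (its inverse is written $y\mapsto y\ast^{-1}x$), and $(x\ast y)\ast z=(x\ast z)\ast(y\ast z)$ for all $x,y,z\in X$. A generalized Legendrian rack (GL-rack)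 is a quadruple $(X,\ast,u,d)$ where $(X,\ast)$ is a rack and $u,d:X\to X$ are maps such that for all $x,y\in X$: (1) $ud(x\ast x)=du(x\ast x)=x$; (2) $u(x\ast y)=u(x)\ast y$ and $d(x\ast y)=d(x)\ast y$; (3) $x\ast u(y)=x\ast d(y)=x\ast y$. A GL-rack homomorphism $\phi:(X,\ast_1,u_1,d_1)\to(Y,\ast_2,u_2,d_2)$ is a map with $\phi(a\ast_1 b)=\phi(a)\ast_2\phi(b)$, $\phi u_1=u_2\phi$ and $\phi d_1=d_2\phi$; an isomorphism is a bijective homomorphism. The free GL-rack on a nonempty set $S$ is the set of formal words built from $S$ by the operations $\ast,\ast^{-1},u,d$, modulo the equivalence relation (congruence) generated by the rack and GL-rack identities. A GL-rack presented by generators and relations is the quotient of the free GL-rack on the generators by the congruence generated by the relations. **Fundamental GL-rack.** Let $D(K)$ be a front diagram of an oriented Legendrian knot $K$. An arc of $D(K)$ is a portion of $D(K)$ between two consecutive points (along the knot) each of which is an undercrossing point or a cusp. The fundamental GL-rack $GLR_K$ is the GL-rack generated by the arcs of $D(K)$ with the following relations. - At each cusp, if $a$ is the arc entering the cusp and $b$ the arc leaving it (with respect to the orientation), then $b=u(a)$ if it is an up cusp and $b=d(a)$ if it is a down cusp. - At each crossing, with overcrossing arc $y$, incoming under-arc $a$ and outgoing under-arc $b$, $b=a\ast y$ if the crossing is positive and $b=a\ast^{-1}y$ if the crossing is negative. Up to isomorphism, $GLR_K$ does not depend on the choice of front diagram, since it is preserved by the Legendrian Reidemeister moves. *)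

theory Defs
  imports "HOL-Analysis.Analysis"
begin

section \<open>GL-racks\<close>

record 'a glrack =
  car :: "'a set"
  mul :: "'a \<Rightarrow> 'a \<Rightarrow> 'a"
  up :: "'a \<Rightarrow> 'a"
  down :: "'a \<Rightarrow> 'a"

definition rack_on :: "'a set \<Rightarrow> ('a \<Rightarrow> 'a \<Rightarrow> 'a) \<Rightarrow> bool" where
  "rack_on X m \<longleftrightarrow>
     (\<forall>x\<in>X. bij_betw (\<lambda>y. m y x) X X) \<and>
     (\<forall>x\<in>X. \<forall>y\<in>X. \<forall>z\<in>X. m (m x y) z = m (m x z) (m y z))"

definition gl_rack :: "'a glrack \<Rightarrow> bool" where
  "gl_rack X \<longleftrightarrow>
     rack_on (car X) (mul X) \<and>
     up X \<in> car X \<rightarrow> car X \<and> down X \<in> car X \<rightarrow> car X \<and>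
     (\<forall>x\<in>car X. up X (down X (mul X x x)) = x \<and> down X (up X (mul X x x)) = x) \<and>
     (\<forall>x\<in>car X. \<forall>y\<in>car X.
        up X (mul X x y) = mul X (up X x) y \<and> down X (mul X x y) = mul X (down X x) y) \<and>
     (\<forall>x\<in>car X. \<forall>y\<in>car X.
        mul X x (up X y) = mul X x y \<and> mul X x (down X y) = mul X x y)"

definition glrack_hom :: "('a \<Rightarrow> 'b) \<Rightarrow> 'a glrack \<Rightarrow> 'b glrack \<Rightarrow> bool" where
  "glrack_hom \<phi> X Y \<longleftrightarrow>
     \<phi> \<in> car X \<rightarrow> car Y \<and>
     (\<forall>a\<in>car X. \<forall>b\<in>car X. \<phi> (mul X a b) = mul Y (\<phi> a) (\<phi> b)) \<and>
     (\<forall>a\<in>car X. \<phi> (up X a) = up Y (\<phi> a)) \<and>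
     (\<forall>a\<in>car X. \<phi> (down X a) = down Y (\<phi> a))"

definition glrack_isomorphic :: "'a glrack \<Rightarrow> 'b glrack \<Rightarrow> bool" where
  "glrack_isomorphic X Y \<longleftrightarrow>
     gl_rack X \<and> gl_rack Y \<and> (\<exists>\<phi>. glrack_hom \<phi> X Y \<and> bij_betw \<phi> (car X) (car Y))"


section \<open>GL-racks presented by generators and relations\<close>

datatype 'a glterm =
    Gen 'a
  | Mul "'a glterm" "'a glterm"
  | Div "'a glterm" "'a glterm"  \<comment> \<open>the formal operation \<open>\<ast>\<^sup>-\<^sup>1\<close>\<close>
  | Up "'a glterm"
  | Down "'a glterm"

definition terms_over :: "'a set \<Rightarrow> 'a glterm set" where
  "terms_over S = {t. set_glterm t \<subseteq> S}"

text \<open>The congruence on terms over \<open>S\<close> generated by the GL-rack identities together with the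
  relations \<open>R\<close>. The case \<open>R = {}\<close> yields the free GL-rack on \<open>S\<close>.\<close>

inductive gl_cong :: "'a set \<Rightarrow> ('a glterm \<times> 'a glterm) set \<Rightarrow> 'a glterm \<Rightarrow> 'a glterm \<Rightarrow> bool"
  for S R where
  relation: "(s, t) \<in> R \<Longrightarrow> s \<in> terms_over S \<Longrightarrow> t \<in> terms_over S \<Longrightarrow> gl_cong S R s t"
| refl: "t \<in> terms_over S \<Longrightarrow> gl_cong S R t t"
| sym: "gl_cong S R s t \<Longrightarrow> gl_cong S R t s"
| trans: "gl_cong S R r s \<Longrightarrow> gl_cong S R s t \<Longrightarrow> gl_cong S R r t"
| cong_Mul: "gl_cong S R s s' \<Longrightarrow> gl_cong S R t t' \<Longrightarrow> gl_cong S R (Mul s t) (Mul s' t')"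
| cong_Div: "gl_cong S R s s' \<Longrightarrow> gl_cong S R t t' \<Longrightarrow> gl_cong S R (Div s t) (Div s' t')"
| cong_Up: "gl_cong S R s s' \<Longrightarrow> gl_cong S R (Up s) (Up s')"
| cong_Down: "gl_cong S R s s' \<Longrightarrow> gl_cong S R (Down s) (Down s')"
| Div_Mul: "x \<in> terms_over S \<Longrightarrow> y \<in> terms_over S \<Longrightarrow> gl_cong S R (Div (Mul x y) y) x"
| Mul_Div: "x \<in> terms_over S \<Longrightarrow> y \<in> terms_over S \<Longrightarrow> gl_cong S R (Mul (Div x y) y) x"
| distrib: "x \<in> terms_over S \<Longrightarrow> y \<in> terms_over S \<Longrightarrow> z \<in> terms_over S \<Longrightarrow>
    gl_cong S R (Mul (Mul x y) z) (Mul (Mul x z) (Mul y z))"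
| Up_Down: "x \<in> terms_over S \<Longrightarrow> gl_cong S R (Up (Down (Mul x x))) x"
| Down_Up: "x \<in> terms_over S \<Longrightarrow> gl_cong S R (Down (Up (Mul x x))) x"
| Up_Mul: "x \<in> terms_over S \<Longrightarrow> y \<in> terms_over S \<Longrightarrow> gl_cong S R (Up (Mul x y)) (Mul (Up x) y)"
| Down_Mul: "x \<in> terms_over S \<Longrightarrow> y \<in> terms_over S \<Longrightarrow>
    gl_cong S R (Down (Mul x y)) (Mul (Down x) y)"
| Mul_Up: "x \<in> terms_over S \<Longrightarrow> y \<in> terms_over S \<Longrightarrow> gl_cong S R (Mul x (Up y)) (Mul x y)"
| Mul_Down: "x \<in> terms_over S \<Longrightarrow> y \<in> terms_over S \<Longrightarrow> gl_cong S R (Mul x (Down y)) (Mul x y)"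

definition gl_rel :: "'a set \<Rightarrow> ('a glterm \<times> 'a glterm) set \<Rightarrow> ('a glterm \<times> 'a glterm) set" where
  "gl_rel S R = {(s, t). gl_cong S R s t}"

definition presented_glrack ::
    "'a set \<Rightarrow> ('a glterm \<times> 'a glterm) set \<Rightarrow> 'a glterm set glrack" where
  "presented_glrack S R =
     \<lparr> car = terms_over S // gl_rel S R,
       mul = (\<lambda>A B. gl_rel S R `` {Mul s t | s t. s \<in> A \<and> t \<in> B}),
       up = (\<lambda>A. gl_rel S R `` (Up ` A)),
       down = (\<lambda>A. gl_rel S R `` (Down ` A)) \<rparr>"

lemma terms_over_simps [simp]:
  "Gen a \<in> terms_over S \<longleftrightarrow> a \<in> S"
  "Mul s t \<in> terms_over S \<longleftrightarrow> s \<in> terms_over S \<and> t \<in> terms_over S"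
  "Div s t \<in> terms_over S \<longleftrightarrow> s \<in> terms_over S \<and> t \<in> terms_over S"
  "Up s \<in> terms_over S \<longleftrightarrow> s \<in> terms_over S"
  "Down s \<in> terms_over S \<longleftrightarrow> s \<in> terms_over S"
  by (auto simp: terms_over_def)

lemma gl_cong_terms_over:
  "gl_cong S R s t \<Longrightarrow> s \<in> terms_over S \<and> t \<in> terms_over S"
  by (induction rule: gl_cong.induct) auto

lemma equiv_gl_rel: "equiv (terms_over S) (gl_rel S R)"
proof (rule equivI)
  show "gl_rel S R \<subseteq> terms_over S \<times> terms_over S"
    by (auto simp: gl_rel_def dest: gl_cong_terms_over)
  show "refl_on (terms_over S) (gl_rel S R)"
    by (auto simp: refl_on_def gl_rel_def intro: gl_cong.refl)
  show "sym (gl_rel S R)" "trans (gl_rel S R)"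
    by (auto simp: sym_on_def trans_on_def gl_rel_def intro: gl_cong.sym gl_cong.trans)
qed

lemma presented_glrack_class:
  shows "s \<in> terms_over S \<Longrightarrow> t \<in> terms_over S \<Longrightarrow>
      mul (presented_glrack S R) (gl_rel S R `` {s}) (gl_rel S R `` {t}) = gl_rel S R `` {Mul s t}"
    and "s \<in> terms_over S \<Longrightarrow>
      up (presented_glrack S R) (gl_rel S R `` {s}) = gl_rel S R `` {Up s}"
    and "s \<in> terms_over S \<Longrightarrow>
      down (presented_glrack S R) (gl_rel S R `` {s}) = gl_rel S R `` {Down s}"
proof -
  let ?E = "gl_cong S R"
  have Mul: "?E (Mul s t) w" if "?E s s'" "?E t t'" "?E (Mul s' t') w" for s s' t t' w
    using gl_cong.trans[OF gl_cong.cong_Mul[OF that(1,2)] that(3)] .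
  have Up: "?E (Up s) w" if "?E s s'" "?E (Up s') w" for s s' w
    using gl_cong.trans[OF gl_cong.cong_Up[OF that(1)] that(2)] .
  have Down: "?E (Down s) w" if "?E s s'" "?E (Down s') w" for s s' w
    using gl_cong.trans[OF gl_cong.cong_Down[OF that(1)] that(2)] .
  show "mul (presented_glrack S R) (gl_rel S R `` {s}) (gl_rel S R `` {t}) = gl_rel S R `` {Mul s t}"
    if "s \<in> terms_over S" "t \<in> terms_over S"
    using gl_cong.refl[OF that(1), of R] gl_cong.refl[OF that(2), of R]
    by (simp add: presented_glrack_def gl_rel_def Image_def) (blast intro: Mul)
  show "up (presented_glrack S R) (gl_rel S R `` {s}) = gl_rel S R `` {Up s}"
    if "s \<in> terms_over S"
    using gl_cong.refl[OF that(1), of R]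
    by (simp add: presented_glrack_def gl_rel_def Image_def) (blast intro: Up)
  show "down (presented_glrack S R) (gl_rel S R `` {s}) = gl_rel S R `` {Down s}"
    if "s \<in> terms_over S"
    using gl_cong.refl[OF that(1), of R]
    by (simp add: presented_glrack_def gl_rel_def Image_def) (blast intro: Down)
qed

lemma gl_rack_presented_glrack: "gl_rack (presented_glrack S R)"
proof -
  let ?X = "presented_glrack S R" and ?c = "\<lambda>s. gl_rel S R `` {s}"
  have carI: "?c s \<in> car ?X" if "s \<in> terms_over S" for s
    using that by (simp add: presented_glrack_def quotientI)
  have carE: "\<exists>s\<in>terms_over S. x = ?c s" if "x \<in> car ?X" for x
    using that by (auto simp: presented_glrack_def elim: quotientE)
  have eq: "?c s = ?c t" if "gl_cong S R s t" for s t
    using that equiv_class_eq[OF equiv_gl_rel] by (simp add: gl_rel_def)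
  note cls = presented_glrack_class
  have bij: "bij_betw (\<lambda>y. mul ?X y x) (car ?X) (car ?X)" if x: "x \<in> car ?X" for x
  proof -
    obtain b where b: "b \<in> terms_over S" "x = ?c b" using carE[OF x] by blast
    show ?thesis
      unfolding bij_betw_def
    proof
      show "inj_on (\<lambda>y. mul ?X y x) (car ?X)"
      proof (rule inj_onI)
        fix y z assume yz: "y \<in> car ?X" "z \<in> car ?X" "mul ?X y x = mul ?X z x"
        obtain p q where pq: "p \<in> terms_over S" "y = ?c p" "q \<in> terms_over S" "z = ?c q"
          using carE[OF yz(1)] carE[OF yz(2)] by blast
        have "?c (Mul p b) = ?c (Mul q b)" using yz pq b by (simp add: cls)
        from eq_equiv_class[OF this equiv_gl_rel] have "gl_cong S R (Mul p b) (Mul q b)"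
          using pq b by (simp add: gl_rel_def)
        from gl_cong.cong_Div[OF this gl_cong.refl[OF b(1)]]
        have "gl_cong S R (Div (Mul p b) b) (Div (Mul q b) b)" .
        from gl_cong.trans[OF this gl_cong.Div_Mul[OF pq(3) b(1)]]
        have "gl_cong S R p q"
          by (rule gl_cong.trans[OF gl_cong.sym[OF gl_cong.Div_Mul[OF pq(1) b(1)]]])
        then show "y = z" using eq pq by simp
      qed
      show "(\<lambda>y. mul ?X y x) ` car ?X = car ?X"
      proof
        show "(\<lambda>y. mul ?X y x) ` car ?X \<subseteq> car ?X"
          using b carI carE by (fastforce simp: cls)
        show "car ?X \<subseteq> (\<lambda>y. mul ?X y x) ` car ?X"
        proof
          fix y assume "y \<in> car ?X"
          then obtain p where p: "p \<in> terms_over S" "y = ?c p" using carE by blast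
          have "y = mul ?X (?c (Div p b)) x"
            using p b eq[OF gl_cong.Mul_Div[of p S b R]] by (simp add: cls)
          then show "y \<in> (\<lambda>y. mul ?X y x) ` car ?X"
            using p b by (auto intro!: image_eqI[of _ _ "?c (Div p b)"] carI)
        qed
      qed
    qed
  qed
  have all: "(\<forall>x\<in>car ?X. P x) \<longleftrightarrow> (\<forall>s\<in>terms_over S. P (?c s))" for P
    using carI carE by metis
  have closed: "up ?X \<in> car ?X \<rightarrow> car ?X" "down ?X \<in> car ?X \<rightarrow> car ?X"
    unfolding Pi_iff all by (simp_all add: cls carI)
  have "rack_on (car ?X) (mul ?X)"
    unfolding rack_on_def
  proof (intro conjI)
    show "\<forall>x\<in>car ?X. bij_betw (\<lambda>y. mul ?X y x) (car ?X) (car ?X)"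
      using bij by blast
    show "\<forall>x\<in>car ?X. \<forall>y\<in>car ?X. \<forall>z\<in>car ?X.
        mul ?X (mul ?X x y) z = mul ?X (mul ?X x z) (mul ?X y z)"
      unfolding all by (simp add: cls eq gl_cong.distrib)
  qed
  moreover have "\<forall>x\<in>car ?X. up ?X (down ?X (mul ?X x x)) = x \<and> down ?X (up ?X (mul ?X x x)) = x"
    unfolding all by (simp add: cls eq[OF gl_cong.Up_Down] eq[OF gl_cong.Down_Up])
  moreover have "\<forall>x\<in>car ?X. \<forall>y\<in>car ?X.
      up ?X (mul ?X x y) = mul ?X (up ?X x) y \<and> down ?X (mul ?X x y) = mul ?X (down ?X x) y"
    unfolding all by (simp add: cls eq[OF gl_cong.Up_Mul] eq[OF gl_cong.Down_Mul])
  moreover have "\<forall>x\<in>car ?X. \<forall>y\<in>car ?X.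
      mul ?X x (up ?X y) = mul ?X x y \<and> mul ?X x (down ?X y) = mul ?X x y"
    unfolding all by (simp add: cls eq[OF gl_cong.Mul_Up] eq[OF gl_cong.Mul_Down])
  ultimately show ?thesis
    unfolding gl_rack_def using closed by blast
qed


section \<open>Legendrian knots\<close>

text \<open>\<open>C\<^sup>\<infinity>\<close> maps between (finite-dimensional) spaces: \<open>f\<close> is differentiable everywhere and
  each of its directional derivatives is again \<open>C\<^sup>\<infinity>\<close>.\<close>

coinductive smooth_map :: "('a::real_normed_vector \<Rightarrow> 'b::real_normed_vector) \<Rightarrow> bool" where
  "(\<And>p. (f has_derivative f' p) (at p)) \<Longrightarrow> (\<And>v. smooth_map (\<lambda>p. f' p v)) \<Longrightarrow> smooth_map f"

abbreviation velocity :: "(real \<Rightarrow> 'a::real_normed_vector) \<Rightarrow> real \<Rightarrow> 'a" where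
  "velocity c \<equiv> (\<lambda>t. vector_derivative c (at t))"

text \<open>The plane \<open>ker (dz - y dx)\<close> at the point \<open>p = (x, y, z)\<close>.\<close>

definition contact_plane :: "real^3 \<Rightarrow> (real^3) set" where
  "contact_plane p = {v. v $ 3 - p $ 2 * v $ 1 = 0}"

text \<open>An oriented Legendrian knot is given by a 1-periodic regular parametrization
  \<open>\<real>/\<int> \<rightarrow> \<real>\<^sup>3\<close> compatible with its orientation.\<close>

definition legendrian_knot :: "(real \<Rightarrow> real^3) \<Rightarrow> bool" where
  "legendrian_knot \<gamma> \<longleftrightarrow>
     smooth_map \<gamma> \<and>
     (\<forall>t. \<gamma> (t + 1) = \<gamma> t) \<and>
     inj_on \<gamma> {0..<1} \<and>
     (\<forall>t. velocity \<gamma> t \<noteq> 0) \<and>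
     (\<forall>t. velocity \<gamma> t \<in> contact_plane (\<gamma> t))"

definition legendrian_isotopic :: "(real \<Rightarrow> real^3) \<Rightarrow> (real \<Rightarrow> real^3) \<Rightarrow> bool" where
  "legendrian_isotopic K K' \<longleftrightarrow>
     (\<exists>H :: real \<times> real \<Rightarrow> real^3.
        smooth_map H \<and>
        (\<forall>s\<in>{0..1}. legendrian_knot (\<lambda>t. H (s, t))) \<and>
        (\<forall>t. H (0, t) = K t) \<and> (\<forall>t. H (1, t) = K' t))"


section \<open>Front diagrams\<close>

definition front :: "(real \<Rightarrow> real^3) \<Rightarrow> real \<Rightarrow> real \<times> real" where
  "front \<gamma> t = (\<gamma> t $ 1, \<gamma> t $ 3)"

definition det2 :: "real \<times> real \<Rightarrow> real \<times> real \<Rightarrow> real" where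
  "det2 v w = fst v * snd w - snd v * fst w"

definition slope :: "(real \<Rightarrow> real^3) \<Rightarrow> real \<Rightarrow> real" where
  "slope \<gamma> t = snd (velocity (front \<gamma>) t) / fst (velocity (front \<gamma>) t)"

definition cusp :: "(real \<Rightarrow> real^3) \<Rightarrow> real \<Rightarrow> bool" where
  "cusp \<gamma> t \<longleftrightarrow> velocity (front \<gamma>) t = 0"

text \<open>A singular point of a plane curve is a semicubical cusp iff the second and third derivatives
  are linearly independent there.\<close>

definition semicubical :: "(real \<Rightarrow> real^3) \<Rightarrow> real \<Rightarrow> bool" where
  "semicubical \<gamma> t \<longleftrightarrow>
     det2 (velocity (velocity (front \<gamma>)) t) (velocity (velocity (velocity (front \<gamma>))) t) \<noteq> 0"

text \<open>The tangent line at a cusp need not be horizontal, so \<open>z\<close> itself need not be monotone along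
  the knot near the cusp: at an up cusp the knot passes from the lower to the upper branch, where
  the two branches are compared above the same \<open>x\<close>.\<close>

definition up_cusp :: "(real \<Rightarrow> real^3) \<Rightarrow> real \<Rightarrow> bool" where
  "up_cusp \<gamma> t \<longleftrightarrow> cusp \<gamma> t \<and>
     (\<exists>\<epsilon>>0. \<forall>r\<in>{t-\<epsilon><..<t}. \<forall>s\<in>{t<..<t+\<epsilon>}. \<gamma> r $ 1 = \<gamma> s $ 1 \<longrightarrow> \<gamma> r $ 3 < \<gamma> s $ 3)"

definition down_cusp :: "(real \<Rightarrow> real^3) \<Rightarrow> real \<Rightarrow> bool" where
  "down_cusp \<gamma> t \<longleftrightarrow> cusp \<gamma> t \<and>
     (\<exists>\<epsilon>>0. \<forall>r\<in>{t-\<epsilon><..<t}. \<forall>s\<in>{t<..<t+\<epsilon>}. \<gamma> r $ 1 = \<gamma> s $ 1 \<longrightarrow> \<gamma> r $ 3 > \<gamma> s $ 3)"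

definition double_point :: "(real \<Rightarrow> real^3) \<Rightarrow> real \<Rightarrow> real \<Rightarrow> bool" where
  "double_point \<gamma> s t \<longleftrightarrow> front \<gamma> s = front \<gamma> t \<and> \<gamma> s \<noteq> \<gamma> t"

definition generic_front :: "(real \<Rightarrow> real^3) \<Rightarrow> bool" where
  "generic_front \<gamma> \<longleftrightarrow>
     (\<forall>t. fst (velocity (front \<gamma>) t) = 0 \<longrightarrow> cusp \<gamma> t) \<and>
     (\<forall>t. cusp \<gamma> t \<longrightarrow> semicubical \<gamma> t) \<and>
     finite {t\<in>{0..<1}. cusp \<gamma> t} \<and>
     (\<forall>s t. double_point \<gamma> s t \<longrightarrow> det2 (velocity (front \<gamma>) s) (velocity (front \<gamma>) t) \<noteq> 0) \<and>
     (\<forall>r s t. \<not> (double_point \<gamma> r s \<and> double_point \<gamma> s t \<and> double_point \<gamma> r t)) \<and>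
     finite {(s, t). s \<in> {0..<1} \<and> t \<in> {0..<1} \<and> double_point \<gamma> s t}"

text \<open>\<open>\<gamma>\<close> has a generic front and represents the Legendrian isotopy class of \<open>K\<close>; thus the front
  of \<open>\<gamma>\<close> is a front diagram of \<open>K\<close>. If the front of \<open>K\<close> is already generic, \<open>\<gamma> = K\<close> is allowed.\<close>

definition front_diagram_of :: "(real \<Rightarrow> real^3) \<Rightarrow> (real \<Rightarrow> real^3) \<Rightarrow> bool" where
  "front_diagram_of K \<gamma> \<longleftrightarrow> legendrian_isotopic K \<gamma> \<and> generic_front \<gamma>"

text \<open>A crossing is recorded by the parameters of its over- and its underpass.\<close>

definition crossing :: "(real \<Rightarrow> real^3) \<Rightarrow> real \<Rightarrow> real \<Rightarrow> bool" where
  "crossing \<gamma> p q \<longleftrightarrow> double_point \<gamma> p q \<and> slope \<gamma> p < slope \<gamma> q"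

text \<open>In the oriented \<open>(x, z)\<close>-plane, a crossing is positive iff its overcrossing direction followed
  by its undercrossing direction is a positively oriented basis.\<close>

definition crossing_sign :: "(real \<Rightarrow> real^3) \<Rightarrow> real \<Rightarrow> real \<Rightarrow> real" where
  "crossing_sign \<gamma> p q = sgn (det2 (velocity (front \<gamma>) p) (velocity (front \<gamma>) q))"


section \<open>Classical invariants\<close>

definition writhe :: "(real \<Rightarrow> real^3) \<Rightarrow> real" where
  "writhe \<gamma> =
     (\<Sum>(p, q) \<in> {(p, q). p \<in> {0..<1} \<and> q \<in> {0..<1} \<and> crossing \<gamma> p q}. crossing_sign \<gamma> p q)"

definition n_up :: "(real \<Rightarrow> real^3) \<Rightarrow> nat" where
  "n_up \<gamma> = card {t\<in>{0..<1}. up_cusp \<gamma> t}"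

definition n_down :: "(real \<Rightarrow> real^3) \<Rightarrow> nat" where
  "n_down \<gamma> = card {t\<in>{0..<1}. down_cusp \<gamma> t}"

definition tb :: "(real \<Rightarrow> real^3) \<Rightarrow> real" where
  "tb \<gamma> = writhe \<gamma> - (real (n_down \<gamma>) + real (n_up \<gamma>)) / 2"

definition rot :: "(real \<Rightarrow> real^3) \<Rightarrow> real" where
  "rot \<gamma> = (real (n_down \<gamma>) - real (n_up \<gamma>)) / 2"


section \<open>The fundamental GL-rack of a front diagram\<close>

definition break_point :: "(real \<Rightarrow> real^3) \<Rightarrow> real \<Rightarrow> bool" where
  "break_point \<gamma> t \<longleftrightarrow> cusp \<gamma> t \<or> (\<exists>p. crossing \<gamma> p t)"

definition consecutive :: "(real \<Rightarrow> real^3) \<Rightarrow> real \<Rightarrow> real \<Rightarrow> bool" where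
  "consecutive \<gamma> a b \<longleftrightarrow>
     a < b \<and> break_point \<gamma> a \<and> break_point \<gamma> b \<and> (\<forall>t\<in>{a<..<b}. \<not> break_point \<gamma> t)"

text \<open>An arc of the diagram is represented by the portion of the knot lying over it (without
  endpoints), so that it does not depend on the choice of parameters modulo 1.\<close>

definition arc_between :: "(real \<Rightarrow> real^3) \<Rightarrow> real \<Rightarrow> real \<Rightarrow> (real^3) set" where
  "arc_between \<gamma> a b = \<gamma> ` {a<..<b}"

definition arcs :: "(real \<Rightarrow> real^3) \<Rightarrow> (real^3) set set" where
  "arcs \<gamma> = {arc_between \<gamma> a b | a b. consecutive \<gamma> a b}"

text \<open>Below, \<open>a\<close>, \<open>t\<close>, \<open>b\<close> are successive break points: the arc entering \<open>t\<close> is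
  \<open>arc_between \<gamma> a t\<close> and the arc leaving \<open>t\<close> is \<open>arc_between \<gamma> t b\<close>.\<close>

definition cusp_relations :: "(real \<Rightarrow> real^3) \<Rightarrow> ((real^3) set glterm \<times> (real^3) set glterm) set" where
  "cusp_relations \<gamma> =
     {(Gen (arc_between \<gamma> t b), Up (Gen (arc_between \<gamma> a t))) | a t b.
        consecutive \<gamma> a t \<and> consecutive \<gamma> t b \<and> up_cusp \<gamma> t} \<union>
     {(Gen (arc_between \<gamma> t b), Down (Gen (arc_between \<gamma> a t))) | a t b.
        consecutive \<gamma> a t \<and> consecutive \<gamma> t b \<and> down_cusp \<gamma> t}"

definition crossing_relations ::
    "(real \<Rightarrow> real^3) \<Rightarrow> ((real^3) set glterm \<times> (real^3) set glterm) set" where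
  "crossing_relations \<gamma> =
     {(Gen (arc_between \<gamma> t b), Mul (Gen (arc_between \<gamma> a t)) (Gen (arc_between \<gamma> c d))) | a t b c d p.
        consecutive \<gamma> a t \<and> consecutive \<gamma> t b \<and> consecutive \<gamma> c d \<and> p \<in> {c<..<d} \<and>
        crossing \<gamma> p t \<and> crossing_sign \<gamma> p t > 0} \<union>
     {(Gen (arc_between \<gamma> t b), Div (Gen (arc_between \<gamma> a t)) (Gen (arc_between \<gamma> c d))) | a t b c d p.
        consecutive \<gamma> a t \<and> consecutive \<gamma> t b \<and> consecutive \<gamma> c d \<and> p \<in> {c<..<d} \<and>
        crossing \<gamma> p t \<and> crossing_sign \<gamma> p t < 0}"

definition GLR :: "(real \<Rightarrow> real^3) \<Rightarrow> (real^3) set glterm set glrack" where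
  "GLR \<gamma> = presented_glrack (arcs \<gamma>) (cusp_relations \<gamma> \<union> crossing_relations \<gamma>)"

end

theory Submission
  imports Defs "HOL-Number_Theory.Cong"
begin

text \<open>Consider the quotient of \<open>GLR\<close> by the relations \<open>x \<ast> y = x \<ast> x\<close>. In it \<open>u\<close> and the kink map
  \<open>x \<mapsto> x \<ast> x\<close> act as commuting translations, and \<open>d\<close> is the inverse of their composite. Walking once
  around the knot shows that this quotient is \<open>\<int>\<^sup>2\<close> modulo the cyclic subgroup generated by
  \<open>(U - D, w - D) = (- 2 rot, tb - rot)\<close>, so this vector is determined up to sign. To avoid forming
  the quotient, we probe it by functions \<open>f\<close> on \<open>GLR\<close> that modulo \<open>n\<close> increase by \<open>\<alpha>\<close> under \<open>u\<close> and
  by \<open>\<beta>\<close> under every right translation: such an \<open>f\<close> exists iff \<open>n\<close> divides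
  \<open>\<alpha> (U - D) + \<beta> (w - D)\<close>.\<close>

section \<open>Weightings of GL-racks\<close>

text \<open>A weighting is a homomorphism into \<open>\<int>/n\<close> with
  \<open>x \<ast> y = x + \<beta>\<close>, \<open>u(x) = x + \<alpha>\<close> and
  \<open>d(x) = x - \<alpha> - \<beta>\<close>, given by integer representatives of its values. The
  shift of \<open>d\<close> is forced by \<open>u(d(x \<ast> x)) = x\<close>. For
  \<open>n = 0\<close> congruence is equality.\<close>

definition gl_weighting :: "int \<Rightarrow> int \<Rightarrow> int \<Rightarrow> 'a glrack \<Rightarrow> ('a \<Rightarrow> int) \<Rightarrow> bool" where
  "gl_weighting n \<alpha> \<beta> X f \<longleftrightarrow>
     (\<forall>x\<in>car X. \<forall>y\<in>car X. [f (mul X x y) = f x + \<beta>] (mod n)) \<and>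
     (\<forall>x\<in>car X. [f (up X x) = f x + \<alpha>] (mod n)) \<and>
     (\<forall>x\<in>car X. [f (down X x) = f x - \<alpha> - \<beta>] (mod n))"

lemma gl_weighting_comp_hom:
  assumes "glrack_hom \<phi> X Y" "gl_weighting n \<alpha> \<beta> Y f"
  shows "gl_weighting n \<alpha> \<beta> X (f \<circ> \<phi>)"
  using assms unfolding glrack_hom_def gl_weighting_def by (auto simp: Pi_iff)

lemma glrack_hom_inv_into:
  assumes X: "gl_rack X" and \<phi>: "glrack_hom \<phi> X Y" and bij: "bij_betw \<phi> (car X) (car Y)"
  shows "glrack_hom (inv_into (car X) \<phi>) Y X"
proof -
  let ?\<psi> = "inv_into (car X) \<phi>"
  \<comment> \<open>Closure under \<open>mul\<close> is only implicit in \<open>rack_on\<close>: it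
    is part of the bijectivity of right translations.\<close>
  have closed: "mul X x y \<in> car X" "up X x \<in> car X" "down X x \<in> car X"
    if "x \<in> car X" "y \<in> car X" for x y
    using X that unfolding gl_rack_def rack_on_def by (auto dest: bij_betwE)
  then have closed': "up X x \<in> car X" "down X x \<in> car X" if "x \<in> car X" for x
    using that by blast+
  have in_car: "?\<psi> b \<in> car X" and right: "\<phi> (?\<psi> b) = b" if "b \<in> car Y" for b
    using bij that by (auto simp: bij_betw_def inv_into_into f_inv_into_f)
  have left: "?\<psi> b = a" if "a \<in> car X" "\<phi> a = b" for a b
    using bij that by (auto simp: bij_betw_def)
  have hom: "\<phi> (mul X a b) = mul Y (\<phi> a) (\<phi> b)" "\<phi> (up X a) = up Y (\<phi> a)"
    "\<phi> (down X a) = down Y (\<phi> a)" if "a \<in> car X" "b \<in> car X" for a b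
    using \<phi> that by (auto simp: glrack_hom_def)
  from hom(2,3) have hom': "\<phi> (up X a) = up Y (\<phi> a)" "\<phi> (down X a) = down Y (\<phi> a)"
    if "a \<in> car X" for a using that by blast+
  show ?thesis
    unfolding glrack_hom_def
    by (auto intro!: left closed(1) closed' in_car simp: hom(1) hom' right in_car)
qed

text \<open>Weightings pull back along homomorphisms. Pulling back along the isomorphism and along
  its inverse makes their existence an isomorphism invariant.\<close>

lemma glrack_isomorphic_weighting_iff:
  assumes "glrack_isomorphic X Y"
  shows "(\<exists>f. gl_weighting n \<alpha> \<beta> X f) \<longleftrightarrow> (\<exists>f. gl_weighting n \<alpha> \<beta> Y f)"
proof -
  obtain \<phi> where "gl_rack X" "glrack_hom \<phi> X Y" "bij_betw \<phi> (car X) (car Y)"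
    using assms by (auto simp: glrack_isomorphic_def)
  then show ?thesis
    using gl_weighting_comp_hom glrack_hom_inv_into by metis
qed

section \<open>Weightings of presented GL-racks\<close>

primrec term_weight :: "int \<Rightarrow> int \<Rightarrow> ('a \<Rightarrow> int) \<Rightarrow> 'a glterm \<Rightarrow> int" where
  "term_weight \<alpha> \<beta> g (Gen a) = g a"
| "term_weight \<alpha> \<beta> g (Mul s t) = term_weight \<alpha> \<beta> g s + \<beta>"
| "term_weight \<alpha> \<beta> g (Div s t) = term_weight \<alpha> \<beta> g s - \<beta>"
| "term_weight \<alpha> \<beta> g (Up s) = term_weight \<alpha> \<beta> g s + \<alpha>"
| "term_weight \<alpha> \<beta> g (Down s) = term_weight \<alpha> \<beta> g s - \<alpha> - \<beta>"

text \<open>\<open>term_weight\<close> evaluates terms in the integers, where every operation shifts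
  its first argument. There both sides of each GL-rack identity have equal weight, so only the
  relations in \<open>R\<close> have to be checked.\<close>

lemma term_weight_gl_cong:
  assumes "gl_cong S R s t"
    and "\<And>s t. (s, t) \<in> R \<Longrightarrow> s \<in> terms_over S \<Longrightarrow> t \<in> terms_over S \<Longrightarrow>
      [term_weight \<alpha> \<beta> g s = term_weight \<alpha> \<beta> g t] (mod n)"
  shows "[term_weight \<alpha> \<beta> g s = term_weight \<alpha> \<beta> g t] (mod n)"
  using assms(1)
proof induction
  case (sym s t)
  then show ?case by (simp add: cong_sym)
next
  case (trans r s t)
  then show ?case by (blast intro: cong_trans)
next
  case (cong_Down s s')
  then show ?case by (simp add: cong_diff)
next
  case (Up_Mul x y)
  then show ?case by (simp add: add.commute add.left_commute)
next
  case (Down_Mul x y)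
  then show ?case by (simp add: algebra_simps)
qed (auto intro: assms(2) cong_add cong_diff)

text \<open>The universal property of the presentation: a weighting is determined modulo
  \<open>n\<close> by its values on generators, and prescribed values extend iff they respect the
  relations. The restriction to \<open>terms_over S\<close> mirrors the rule \<open>relation\<close>
  of \<open>gl_cong\<close>.\<close>

lemma presented_glrack_weighting_iff:
  "(\<exists>f. gl_weighting n \<alpha> \<beta> (presented_glrack S R) f) \<longleftrightarrow>
   (\<exists>g. \<forall>(s, t)\<in>R. s \<in> terms_over S \<longrightarrow> t \<in> terms_over S \<longrightarrow>
      [term_weight \<alpha> \<beta> g s = term_weight \<alpha> \<beta> g t] (mod n))"
proof -
  let ?X = "presented_glrack S R" and ?c = "\<lambda>s. gl_rel S R `` {s}"
  have carI: "?c s \<in> car ?X" if "s \<in> terms_over S" for s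
    using that by (simp add: presented_glrack_def quotientI)
  have carE: "\<exists>s\<in>terms_over S. x = ?c s" if "x \<in> car ?X" for x
    using that by (auto simp: presented_glrack_def elim: quotientE)
  have all: "(\<forall>x\<in>car ?X. P x) \<longleftrightarrow> (\<forall>s\<in>terms_over S. P (?c s))" for P
    using carI carE by metis
  have eq: "?c s = ?c t" if "gl_cong S R s t" for s t
    using that equiv_class_eq[OF equiv_gl_rel] by (simp add: gl_rel_def)
  show ?thesis
  proof
    assume "\<exists>f. gl_weighting n \<alpha> \<beta> ?X f"
    then obtain f where f: "gl_weighting n \<alpha> \<beta> ?X f" by blast
    define g where "g a = f (?c (Gen a))" for a
    have fMul: "[f (?c (Mul s t)) = f (?c s) + \<beta>] (mod n)"
      if "s \<in> terms_over S" "t \<in> terms_over S" for s t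
      using f carI that presented_glrack_class(1)[OF that, of R] unfolding gl_weighting_def by metis
    have f_weight: "[f (?c s) = term_weight \<alpha> \<beta> g s] (mod n)" if "s \<in> terms_over S" for s
      using that
    proof (induction s)
      case (Gen a)
      then show ?case by (simp add: g_def)
    next
      case (Mul s t)
      then have "[f (?c s) + \<beta> = term_weight \<alpha> \<beta> g s + \<beta>] (mod n)"
        by (auto intro: cong_add)
      then show ?case using fMul[of s t] Mul.prems by (auto intro: cong_trans)
    next
      case (Div s t)
      \<comment> \<open>The inverse operation is no field of the record, so its effect on
        \<open>f\<close> is derived from the law for \<open>Mul\<close> at \<open>Div s t\<close>
        and \<open>t\<close>.\<close>
      have "?c (Mul (Div s t) t) = ?c s"
        using Div.prems by (intro eq gl_cong.Mul_Div) auto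
      with fMul[of "Div s t" t] Div.prems have "[f (?c s) = f (?c (Div s t)) + \<beta>] (mod n)"
        by simp
      then have "[f (?c s) - \<beta> = f (?c (Div s t)) + \<beta> - \<beta>] (mod n)"
        by (intro cong_diff) auto
      moreover have "[f (?c s) - \<beta> = term_weight \<alpha> \<beta> g s - \<beta>] (mod n)"
        using Div by (intro cong_diff) auto
      ultimately show ?case by (simp add: cong_def)
    next
      case (Up s)
      have "[f (?c (Up s)) = f (?c s) + \<alpha>] (mod n)"
        using f carI Up.prems presented_glrack_class(2)[of s S R]
        unfolding gl_weighting_def by (metis terms_over_simps(4))
      moreover have "[f (?c s) + \<alpha> = term_weight \<alpha> \<beta> g s + \<alpha>] (mod n)"
        using Up by (intro cong_add) auto
      ultimately show ?case by (auto intro: cong_trans)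
    next
      case (Down s)
      have "[f (?c (Down s)) = f (?c s) - \<alpha> - \<beta>] (mod n)"
        using f carI Down.prems presented_glrack_class(3)[of s S R]
        unfolding gl_weighting_def by (metis terms_over_simps(5))
      moreover have "[f (?c s) - \<alpha> - \<beta> = term_weight \<alpha> \<beta> g s - \<alpha> - \<beta>] (mod n)"
        using Down by (intro cong_diff) auto
      ultimately show ?case by (auto intro: cong_trans)
    qed
    have "[term_weight \<alpha> \<beta> g s = term_weight \<alpha> \<beta> g t] (mod n)"
      if "(s, t) \<in> R" "s \<in> terms_over S" "t \<in> terms_over S" for s t
      using f_weight[OF that(2)] f_weight[OF that(3)] eq[OF gl_cong.relation[OF that]]
      by (simp add: cong_def)
    then show "\<exists>g. \<forall>(s, t)\<in>R. s \<in> terms_over S \<longrightarrow> t \<in> terms_over S \<longrightarrow>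
      [term_weight \<alpha> \<beta> g s = term_weight \<alpha> \<beta> g t] (mod n)" by blast
  next
    assume "\<exists>g. \<forall>(s, t)\<in>R. s \<in> terms_over S \<longrightarrow> t \<in> terms_over S \<longrightarrow>
      [term_weight \<alpha> \<beta> g s = term_weight \<alpha> \<beta> g t] (mod n)"
    then obtain g where g: "\<And>s t. (s, t) \<in> R \<Longrightarrow> s \<in> terms_over S \<Longrightarrow> t \<in> terms_over S \<Longrightarrow>
      [term_weight \<alpha> \<beta> g s = term_weight \<alpha> \<beta> g t] (mod n)" by blast
    \<comment> \<open>The representative is arbitrary. Another choice changes the value by a
      multiple of \<open>n\<close>, which is why weightings are defined by congruences.\<close>
    define f where "f A = term_weight \<alpha> \<beta> g (SOME s. s \<in> A)" for A
    have f_weight: "[f (?c s) = term_weight \<alpha> \<beta> g s] (mod n)" if "s \<in> terms_over S" for s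
    proof -
      have "s \<in> ?c s" using that by (simp add: gl_rel_def gl_cong.refl)
      then have "(SOME t. t \<in> ?c s) \<in> ?c s" by (rule someI)
      then have "gl_cong S R s (SOME t. t \<in> ?c s)" by (simp add: gl_rel_def)
      from term_weight_gl_cong[OF this g] show ?thesis by (simp add: f_def cong_sym)
    qed
    have step: "[f (?c t) = f (?c s) + k] (mod n)"
      if "s \<in> terms_over S" "t \<in> terms_over S" "term_weight \<alpha> \<beta> g t = term_weight \<alpha> \<beta> g s + k" for s t k
      using f_weight[OF that(2)] cong_add[OF f_weight[OF that(1)] cong_refl[of k]] that(3)
      by (simp add: cong_def)
    \<comment> \<open>Writing subtraction as addition of a negative brings the laws for all three
      operations into the form treated by \<open>step\<close>.\<close>
    have "gl_weighting n \<alpha> \<beta> ?X f"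
      unfolding gl_weighting_def all diff_conv_add_uminus add.assoc
      by (auto simp: presented_glrack_class intro!: step)
    then show "\<exists>f. gl_weighting n \<alpha> \<beta> ?X f" by blast
  qed
qed


section \<open>Locally finite periodic sets of reals\<close>

text \<open>The codomain is arbitrary, so that the lemma also applies to predicates such as
  membership in a periodic set.\<close>

lemma periodic_of_int:
  fixes f :: "real \<Rightarrow> 'a"
  assumes "\<And>t. f (t + 1) = f t"
  shows "f (t + of_int k) = f t"
proof (induction k rule: int_induct[where k = 0])
  case (step1 i)
  then show ?case using assms[of "t + of_int i"] by (simp add: add.assoc)
next
  case (step2 i)
  then show ?case using assms[of "t + of_int (i - 1)"] by (simp add: add.assoc)
qed simp

text \<open>Such a \<open>B\<close> is the lift to the real line of a finite nonempty subset of the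
  circle \<open>\<real>/\<int>\<close>. On the line, successive points bound an ordinary interval
  even if the circle carries only one of them.\<close>

locale periodic_points =
  fixes B :: "real set"
  assumes nonempty: "B \<noteq> {}"
    and periodic: "t + 1 \<in> B \<longleftrightarrow> t \<in> B"
    and finite_period: "finite (B \<inter> {0..<1})"
begin

definition gap :: "real \<Rightarrow> real \<Rightarrow> bool" where
  "gap a b \<longleftrightarrow> a < b \<and> a \<in> B \<and> b \<in> B \<and> {a<..<b} \<inter> B = {}"

lemma shift_int: "t + of_int k \<in> B \<longleftrightarrow> t \<in> B"
  using periodic_of_int[of "\<lambda>t. t \<in> B"] periodic by blast

lemma frac_in: "frac t \<in> B \<longleftrightarrow> t \<in> B"
  using shift_int[of t "- \<lfloor>t\<rfloor>"] by (simp add: frac_def)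

lemma finite_Icc: "finite (B \<inter> {a..b})"
proof (rule finite_subset)
  show "B \<inter> {a..b} \<subseteq> (\<lambda>(k, s). of_int k + s) ` ({\<lfloor>a\<rfloor>..\<lfloor>b\<rfloor>} \<times> (B \<inter> {0..<1}))"
  proof
    fix t assume "t \<in> B \<inter> {a..b}"
    then have "(\<lfloor>t\<rfloor>, frac t) \<in> {\<lfloor>a\<rfloor>..\<lfloor>b\<rfloor>} \<times> (B \<inter> {0..<1})"
      by (auto simp: frac_in frac_lt_1 intro: floor_mono)
    then show "t \<in> (\<lambda>(k, s). of_int k + s) ` ({\<lfloor>a\<rfloor>..\<lfloor>b\<rfloor>} \<times> (B \<inter> {0..<1}))"
      by (rule rev_image_eqI) (simp add: frac_def)
  qed
qed (use finite_period in auto)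

lemma ex_next: "\<exists>b\<in>B. t < b \<and> {t<..<b} \<inter> B = {}"
proof -
  obtain u where "u \<in> B" using nonempty by blast
  \<comment> \<open>This is the translate of \<open>u\<close> lying beyond \<open>t\<close> by at
    most 1. It confines the search for the next point to a finite set.\<close>
  define v where "v = u + of_int (\<lfloor>t - u\<rfloor> + 1)"
  have v: "v \<in> B" using \<open>u \<in> B\<close> shift_int unfolding v_def by blast
  have "t < v" unfolding v_def by linarith
  let ?F = "B \<inter> {t..v} - {t}"
  have F: "finite ?F" "?F \<noteq> {}" using finite_Icc v \<open>t < v\<close> by auto
  define b where "b = Min ?F"
  have b: "b \<in> ?F" "\<And>s. s \<in> ?F \<Longrightarrow> b \<le> s" using Min_in[OF F] Min_le[OF F(1)] unfolding b_def by blast+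
  have "{t<..<b} \<inter> B = {}"
  proof (rule ccontr)
    assume "{t<..<b} \<inter> B \<noteq> {}"
    then obtain s where s: "s \<in> B" "t < s" "s < b" by auto
    with b(1) have "s \<in> ?F" by auto
    with b(2) s show False by fastforce
  qed
  then show ?thesis using b(1) by force
qed

lemma ex_prev: "\<exists>a\<in>B. a < t \<and> {a<..<t} \<inter> B = {}"
proof -
  obtain u where "u \<in> B" using nonempty by blast
  define v where "v = u + of_int (\<lceil>t - u\<rceil> - 1)"
  have v: "v \<in> B" using \<open>u \<in> B\<close> shift_int unfolding v_def by blast
  have "v < t" unfolding v_def by linarith
  let ?F = "B \<inter> {v..t} - {t}"
  have F: "finite ?F" "?F \<noteq> {}" using finite_Icc v \<open>v < t\<close> by auto
  define a where "a = Max ?F"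
  have a: "a \<in> ?F" "\<And>s. s \<in> ?F \<Longrightarrow> s \<le> a" using Max_in[OF F] Max_ge[OF F(1)] unfolding a_def by blast+
  have "{a<..<t} \<inter> B = {}"
  proof (rule ccontr)
    assume "{a<..<t} \<inter> B \<noteq> {}"
    then obtain s where s: "s \<in> B" "a < s" "s < t" by auto
    with a(1) have "s \<in> ?F" by auto
    with a(2) s show False by fastforce
  qed
  then show ?thesis using a(1) by force
qed

lemma gap_shift: "gap a b \<Longrightarrow> gap (a + of_int k) (b + of_int k)"
proof -
  assume g: "gap a b"
  have "s \<notin> B" if "a + of_int k < s" "s < b + of_int k" for s
    using g that shift_int[of s "-k"] unfolding gap_def by (force simp: disjoint_iff)
  then show ?thesis using g shift_int unfolding gap_def by auto
qed

text \<open>No endpoint of either gap lies inside the other. Later this identifies an arc from a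
  single point on it.\<close>

lemma gap_unique:
  assumes "gap a b" "gap a' b'" "s \<in> {a<..<b}" "s \<in> {a'<..<b'}"
  shows "a = a'" "b = b'"
proof -
  have "x \<notin> {a<..<b}" "x \<notin> {a'<..<b'}" if "x \<in> B" for x
    using assms that unfolding gap_def by blast+
  note * = this
  have "a \<in> B" "b \<in> B" "a' \<in> B" "b' \<in> B" using assms unfolding gap_def by auto
  with assms(3,4) *[of a] *[of a'] *[of b] *[of b'] show "a = a'" "b = b'" by force+
qed

lemma gap_le_1: "gap a b \<Longrightarrow> b \<le> a + 1"
  using periodic[of a] unfolding gap_def by (force simp: disjoint_iff)

text \<open>The discrete analogue of the fact that a form on the circle is exact iff its integral
  over one period vanishes, here modulo \<open>n\<close>. The increment across a gap is charged to
  its right endpoint, the break point at which an arc ends.\<close>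

theorem potential_exists_iff:
  fixes W :: "real \<Rightarrow> int"
  assumes W: "\<And>t. W (t + 1) = W t"
  shows "(\<exists>P. (\<forall>t\<in>B. P (t + 1) = P t) \<and> (\<forall>a b. gap a b \<longrightarrow> [P b = P a + W b] (mod n))) \<longleftrightarrow>
    n dvd (\<Sum>t\<in>B \<inter> {0..<1}. W t)"
proof
  assume "\<exists>P. (\<forall>t\<in>B. P (t + 1) = P t) \<and> (\<forall>a b. gap a b \<longrightarrow> [P b = P a + W b] (mod n))"
  then obtain P where P1: "\<And>t. t \<in> B \<Longrightarrow> P (t + 1) = P t"
    and P2: "\<And>a b. gap a b \<Longrightarrow> [P b = P a + W b] (mod n)" by blast
  obtain u where "u \<in> B" using nonempty by blast
  then have ne: "B \<inter> {0..<1} \<noteq> {}" using frac_in[of u] frac_lt_1[of u] by force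
  define m where "m = Min (B \<inter> {0..<1})"
  define M where "M = Max (B \<inter> {0..<1})"
  have m: "m \<in> B" "0 \<le> m" "m < 1" and M: "M \<in> B" "0 \<le> M" "M < 1"
    using Min_in[OF finite_period ne] Max_in[OF finite_period ne] unfolding m_def M_def by auto
  have m_le: "m \<le> s" and M_ge: "s \<le> M" if "s \<in> B" "0 \<le> s" "s < 1" for s
    using finite_period that unfolding m_def M_def by auto
  \<comment> \<open>\<open>P m\<close> already contains the increment at the first point
    \<open>m\<close>, while the sum counts it again; hence \<open>- W m\<close>.\<close>
  have sum: "[P b = P m - W m + (\<Sum>t\<in>B \<inter> {0..b}. W t)] (mod n)"
    if "b \<in> B" "0 \<le> b" "b < 1" for b
    using that
  proof (induction "card (B \<inter> {0..b})" arbitrary: b rule: less_induct)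
    case less
    show ?case
    proof (cases "b = m")
      case True
      then have "B \<inter> {0..b} = {m}" using m m_le less.prems by force
      then show ?thesis using True by simp
    next
      case False
      then have "m < b" using m_le less.prems by force
      obtain a where a: "a \<in> B" "a < b" "{a<..<b} \<inter> B = {}" using ex_prev by blast
      have "m \<le> a" using a m \<open>m < b\<close> by force
      have ins: "B \<inter> {0..b} = insert b (B \<inter> {0..a})"
        using a m \<open>m \<le> a\<close> less.prems by force
      have "[P a = P m - W m + (\<Sum>t\<in>B \<inter> {0..a}. W t)] (mod n)"
      proof (rule less.hyps)
        show "card (B \<inter> {0..a}) < card (B \<inter> {0..b})"
          using ins finite_Icc[of 0 a] a by simp
      qed (use a m \<open>m \<le> a\<close> less.prems in auto)
      from cong_add[OF this cong_refl[of "W b"]]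
      have "[P a + W b = P m - W m + (\<Sum>t\<in>B \<inter> {0..b}. W t)] (mod n)"
        using ins finite_Icc[of 0 a] a by (simp add: algebra_simps)
      moreover have "[P b = P a + W b] (mod n)"
        using a less.prems by (intro P2) (auto simp: gap_def)
      ultimately show ?thesis by (rule cong_trans[rotated])
    qed
  qed
  \<comment> \<open>This gap runs from the last point of the period to the first point of the next
    one and closes the loop.\<close>
  have "gap M (m + 1)"
    unfolding gap_def
  proof (intro conjI)
    show "{M<..<m + 1} \<inter> B = {}"
    proof (rule ccontr)
      assume "{M<..<m + 1} \<inter> B \<noteq> {}"
      then obtain s where s: "s \<in> B" "M < s" "s < m + 1" by auto
      show False
      proof (cases "s < 1")
        case True
        then show False using M_ge[of s] s M by auto
      next
        case False
        then show False using m_le[of "s - 1"] periodic[of "s - 1"] s m by auto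
      qed
    qed
  qed (use m M periodic in auto)
  from P2[OF this] have "[P m = P M + W m] (mod n)" using P1 W m by simp
  moreover have "B \<inter> {0..M} = B \<inter> {0..<1}" using M M_ge by force
  with sum[OF M] have "[P M = P m - W m + (\<Sum>t\<in>B \<inter> {0..<1}. W t)] (mod n)" by simp
  \<comment> \<open>Adding the two congruences cancels all values of \<open>P\<close> and the term
    \<open>W m\<close>, leaving the total up to sign.\<close>
  ultimately have "n dvd (P m - (P M + W m)) + (P M - (P m - W m + (\<Sum>t\<in>B \<inter> {0..<1}. W t)))"
    unfolding cong_iff_dvd_diff by (rule dvd_add)
  then show "n dvd (\<Sum>t\<in>B \<inter> {0..<1}. W t)" by simp
next
  assume dvd: "n dvd (\<Sum>t\<in>B \<inter> {0..<1}. W t)"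
  \<comment> \<open>Using \<open>frac t\<close> makes \<open>P\<close> periodic outright. It
    accumulates increments from the start of the period, so only a gap that reaches the next integer
    needs the divisibility.\<close>
  define P where "P t = (\<Sum>s\<in>B \<inter> {0..frac t}. W s)" for t
  have Wfrac: "W (frac t) = W t" for t using periodic_of_int[of W, OF W, of t "- \<lfloor>t\<rfloor>"] by (simp add: frac_def)
  have "[P b = P a + W b] (mod n)" if "gap a b" for a b
  proof -
    define a' where "a' = frac a"
    define b' where "b' = b - of_int \<lfloor>a\<rfloor>"
    have g: "gap a' b'"
      using gap_shift[OF that, of "- \<lfloor>a\<rfloor>"] by (simp add: a'_def b'_def frac_def)
    have a': "0 \<le> a'" "a' < 1" by (auto simp: a'_def frac_lt_1)
    have frac_b: "frac b = frac b'" by (simp add: b'_def frac_def)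
    have W_b: "W b' = W b" by (metis Wfrac frac_b)
    have in_B: "a' \<in> B" "b' \<in> B" "a' < b'" and no_B: "\<And>s. s \<in> B \<Longrightarrow> a' < s \<Longrightarrow> b' \<le> s"
      using g unfolding gap_def by force+
    show ?thesis
    proof (cases "b' < 1")
      case True
      then have "frac b = b'" using a' in_B frac_b by (simp add: frac_eq)
      moreover have "B \<inter> {0..b'} = insert b' (B \<inter> {0..a'})"
        using in_B a' no_B by force
      ultimately have "P b = P a + W b"
        using finite_Icc[of 0 a'] in_B W_b by (simp add: P_def a'_def)
      then show ?thesis by simp
    next
      case False
      \<comment> \<open>Here the gap wraps around: \<open>b' - 1\<close> is the first point of the
        period and \<open>a'\<close> the last. So \<open>P b\<close> is the single increment
        \<open>W b\<close>, and \<open>P a\<close> is the total, which is 0 modulo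
        \<open>n\<close>.\<close>
      have "b' < 2" using gap_le_1[OF g] a' by simp
      then have frac: "frac b = b' - 1"
        using False frac_b frac_1_eq[of "b' - 1"] frac_eq[of "b' - 1"] by simp
      have "s = b' - 1" if "s \<in> B" "0 \<le> s" "s \<le> b' - 1" for s
        using no_B[of "s + 1"] a' that periodic[of s] by simp
      moreover have "b' - 1 \<in> B" using periodic[of "b' - 1"] in_B by simp
      ultimately have "B \<inter> {0..b' - 1} = {b' - 1}" using False by force
      moreover have "W (b' - 1) = W b" using W[of "b' - 1"] W_b by simp
      ultimately have "P b = W b" by (simp add: P_def frac)
      moreover have "B \<inter> {0..a'} = B \<inter> {0..<1}" using a' False no_B by force
      then have "[P a = 0] (mod n)" using dvd by (simp add: P_def a'_def cong_0_iff)
      then have "[P a + W b = 0 + W b] (mod n)" by (intro cong_add) auto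
      ultimately show ?thesis by (simp add: cong_sym)
    qed
  qed
  moreover have "P (t + 1) = P t" for t by (simp add: P_def frac_1_eq)
  ultimately show "\<exists>P. (\<forall>t\<in>B. P (t + 1) = P t) \<and> (\<forall>a b. gap a b \<longrightarrow> [P b = P a + W b] (mod n))"
    by blast
qed

end


section \<open>Cusps and crossings of a generic front\<close>

lemma smooth_map_velocity:
  fixes f :: "real \<Rightarrow> 'a::real_normed_vector"
  assumes "smooth_map f"
  shows "(f has_vector_derivative velocity f t) (at t)" and "smooth_map (velocity f)"
proof -
  from assms obtain f' where f': "\<And>p. (f has_derivative f' p) (at p)"
    "\<And>v. smooth_map (\<lambda>p. f' p v)"
    by (cases rule: smooth_map.cases) blast
  have *: "(f has_vector_derivative f' t 1) (at t)" for t
  proof -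
    have "f' t = (\<lambda>x. x *\<^sub>R f' t 1)"
    proof
      fix x
      show "f' t x = x *\<^sub>R f' t 1"
        using linear_scale[OF has_derivative_linear[OF f'(1)[of t]], of x 1] by simp
    qed
    then show ?thesis unfolding has_vector_derivative_def using f'(1)[of t] by simp
  qed
  then have "velocity f t = f' t 1" for t
    by (rule vector_derivative_at)
  then show "(f has_vector_derivative velocity f t) (at t)" "smooth_map (velocity f)"
    using *[of t] f'(2)[of 1] by simp_all
qed

lemma has_vector_derivative_vec_nth:
  fixes f :: "real \<Rightarrow> real^'n"
  assumes "(f has_vector_derivative v) (at t)"
  shows "((\<lambda>t. f t $ i) has_real_derivative v $ i) (at t)"
  using bounded_linear.has_vector_derivative[OF bounded_linear_vec_nth assms]
  by (simp add: has_real_derivative_iff_has_vector_derivative)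

lemma velocity_front:
  assumes "smooth_map \<gamma>"
  shows "velocity (front \<gamma>) t = (velocity \<gamma> t $ 1, velocity \<gamma> t $ 3)"
proof (rule vector_derivative_at)
  have "((\<lambda>t. \<gamma> t $ i) has_vector_derivative velocity \<gamma> t $ i) (at t)" for i
    using has_vector_derivative_vec_nth[OF smooth_map_velocity(1)[OF assms]]
    by (simp add: has_real_derivative_iff_has_vector_derivative)
  then show "(front \<gamma> has_vector_derivative (velocity \<gamma> t $ 1, velocity \<gamma> t $ 3)) (at t)"
    unfolding front_def by (intro has_vector_derivative_Pair)
qed

text \<open>The quotient \<open>f s / (s - t)\<close> tends to \<open>D\<close>, so its product with
  \<open>D\<close> tends to \<open>D * D > 0\<close>. Multiplying by the square of
  \<open>s - t\<close> gives a condition that treats both sides of \<open>t\<close> and both signs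
  of \<open>D\<close> at once.\<close>

lemma simple_zero_sign:
  fixes f :: "real \<Rightarrow> real"
  assumes "(f has_real_derivative D) (at t)" "f t = 0" "D \<noteq> 0"
  shows "\<forall>\<^sub>F s in at t. D * (s - t) * f s > 0"
proof -
  have "((\<lambda>s. D * (f s / (s - t))) \<longlongrightarrow> D * D) (at t)"
    using assms by (intro tendsto_mult_left) (simp add: has_field_derivative_iff)
  then have "\<forall>\<^sub>F s in at t. D * (f s / (s - t)) > 0"
    by (rule order_tendstoD) (use assms in \<open>auto simp: zero_less_mult_iff linorder_neq_iff\<close>)
  moreover have "\<forall>\<^sub>F s in at t. s \<noteq> t" by (simp add: eventually_at_filter)
  ultimately show ?thesis
  proof eventually_elim
    case (elim s)
    then have "D * (f s / (s - t)) * (s - t)\<^sup>2 > 0"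
      by (intro mult_pos_pos[of "D * (f s / (s - t))"]) auto
    also have "D * (f s / (s - t)) * (s - t)\<^sup>2 = D * (s - t) * f s"
      using elim by (simp add: power2_eq_square)
    finally show ?case .
  qed
qed

text \<open>The intermediate value theorem reaches the lower of the two end values on either side of
  \<open>t\<close>. At a cusp this provides points of both branches above the same
  \<open>x\<close>.\<close>

lemma strict_minimum_same_value:
  fixes f :: "real \<Rightarrow> real"
  assumes "0 < \<delta>" "continuous_on {t - \<delta>..t + \<delta>} f" "f t < f (t - \<delta>)" "f t < f (t + \<delta>)"
  shows "\<exists>r s. t - \<delta> \<le> r \<and> r < t \<and> t < s \<and> s \<le> t + \<delta> \<and> f r = f s"
proof -
  define m where "m = min (f (t - \<delta>)) (f (t + \<delta>))"
  have "\<exists>r. t - \<delta> \<le> r \<and> r \<le> t \<and> f r = m"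
    by (rule IVT2') (use assms in \<open>auto simp: m_def intro: continuous_on_subset\<close>)
  moreover have "\<exists>s. t \<le> s \<and> s \<le> t + \<delta> \<and> f s = m"
    by (rule IVT') (use assms in \<open>auto simp: m_def intro: continuous_on_subset\<close>)
  moreover have "f t \<noteq> m" using assms by (auto simp: m_def min_def)
  ultimately show ?thesis by (metis order_le_less)
qed

section \<open>The contact equation and its derivatives\<close>

locale generic_knot =
  fixes \<gamma> :: "real \<Rightarrow> real^3"
  assumes knot: "legendrian_knot \<gamma>" and generic: "generic_front \<gamma>"
begin

abbreviation "V \<equiv> velocity \<gamma>"
abbreviation "A \<equiv> velocity (velocity \<gamma>)"

lemma smooth: "smooth_map \<gamma>" "smooth_map V" "smooth_map A"
proof -
  show "smooth_map \<gamma>" using knot by (simp add: legendrian_knot_def)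
  from smooth_map_velocity(2)[OF this] show "smooth_map V" .
  from smooth_map_velocity(2)[OF this] show "smooth_map A" .
qed

lemma deriv_coord:
  "((\<lambda>t. \<gamma> t $ i) has_real_derivative V t $ i) (at t)"
  "((\<lambda>t. V t $ i) has_real_derivative A t $ i) (at t)"
  "((\<lambda>t. A t $ i) has_real_derivative velocity A t $ i) (at t)"
  by (rule has_vector_derivative_vec_nth[OF smooth_map_velocity(1)], rule smooth)+

lemma period: "\<gamma> (t + 1) = \<gamma> t" "\<gamma> (t + of_int k) = \<gamma> t"
proof -
  show "\<gamma> (t + 1) = \<gamma> t" for t using knot by (simp add: legendrian_knot_def)
  then show "\<gamma> (t + of_int k) = \<gamma> t" by (rule periodic_of_int)
qed

lemma period_velocity:
  assumes "\<And>t. c (t + 1) = c t" "smooth_map c"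
  shows "velocity c (t + 1) = velocity c t"
proof -
  have "(c has_vector_derivative velocity c (t + 1)) (at (1 + t))"
    using smooth_map_velocity(1)[OF assms(2), of "t + 1"] by (simp add: add.commute)
  moreover have "((+) 1 has_vector_derivative (1 :: real)) (at t)"
    by (auto intro!: derivative_eq_intros)
  ultimately have "((\<lambda>t. c (1 + t)) has_vector_derivative velocity c (t + 1)) (at t)"
    using vector_diff_chain_at[of "(+) 1" 1 t c] by (simp add: o_def)
  then have "(c has_vector_derivative velocity c (t + 1)) (at t)"
    using assms(1) by (simp add: add.commute)
  from vector_derivative_at[OF this] show ?thesis by simp
qed

lemma V_period: "V (t + 1) = V t"
  by (rule period_velocity[OF period(1) smooth(1)])

lemma A_period: "A (t + 1) = A t"
  by (rule period_velocity[OF V_period smooth(2)])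

lemma front_period: "front \<gamma> (t + 1) = front \<gamma> t"
  by (simp add: front_def period)

lemma front_velocity: "velocity (front \<gamma>) t = (V t $ 1, V t $ 3)"
  by (rule velocity_front[OF smooth(1)])

lemma contact: "V t $ 3 = \<gamma> t $ 2 * V t $ 1"
  using knot by (simp add: legendrian_knot_def contact_plane_def)

text \<open>Both sides of \<open>z' = y x'\<close> are differentiated; \<open>contact_J\<close> does
  so once more.\<close>

lemma contact_A: "A t $ 3 = V t $ 2 * V t $ 1 + \<gamma> t $ 2 * A t $ 1"
proof -
  have "((\<lambda>t. \<gamma> t $ 2 * V t $ 1) has_real_derivative V t $ 2 * V t $ 1 + \<gamma> t $ 2 * A t $ 1) (at t)"
    by (auto intro!: derivative_eq_intros deriv_coord simp: algebra_simps)
  then show ?thesis using deriv_coord(2)[of 3 t] DERIV_unique by (simp add: contact)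
qed

lemma contact_J:
  "velocity A t $ 3 = A t $ 2 * V t $ 1 + 2 * (V t $ 2 * A t $ 1) + \<gamma> t $ 2 * velocity A t $ 1"
proof -
  have "((\<lambda>t. V t $ 2 * V t $ 1 + \<gamma> t $ 2 * A t $ 1) has_real_derivative
      A t $ 2 * V t $ 1 + 2 * (V t $ 2 * A t $ 1) + \<gamma> t $ 2 * velocity A t $ 1) (at t)"
    by (auto intro!: derivative_eq_intros deriv_coord simp: algebra_simps)
  then show ?thesis using deriv_coord(3)[of 3 t] DERIV_unique by (simp add: contact_A)
qed

section \<open>Local shape of the front at a cusp\<close>

lemma cusp_iff: "cusp \<gamma> t \<longleftrightarrow> V t $ 1 = 0"
  using contact[of t] by (auto simp: cusp_def front_velocity zero_prod_def)

text \<open>Since \<open>x' = 0\<close> at a cusp, the differentiated contact equations become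
  \<open>z'' = y x''\<close> and \<open>z''' = 2 y' x'' + y x'''\<close>. The determinant in
  \<open>semicubical\<close> is then \<open>2 y' x''^2\<close>.\<close>

lemma cusp_nondegenerate:
  assumes "cusp \<gamma> t"
  shows "A t $ 1 \<noteq> 0" "V t $ 2 \<noteq> 0"
proof -
  have vf: "velocity (\<lambda>t. (c t $ 1, c t $ 3)) t = (velocity c t $ 1, velocity c t $ 3)"
    if "smooth_map c" for c :: "real \<Rightarrow> real^3" and t
    using velocity_front[OF that] unfolding front_def .
  have "semicubical \<gamma> t" using generic assms by (simp add: generic_front_def)
  then have "det2 (A t $ 1, A t $ 3) (velocity A t $ 1, velocity A t $ 3) \<noteq> 0"
    unfolding semicubical_def front_velocity vf[OF smooth(2)] vf[OF smooth(3)] .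
  moreover have "V t $ 1 = 0" using assms cusp_iff by simp
  ultimately show "A t $ 1 \<noteq> 0" "V t $ 2 \<noteq> 0"
    by (auto simp: det2_def contact_J contact_A algebra_simps)
qed

text \<open>At a cusp \<open>t\<close> the function \<open>z - y(t) x\<close> has derivative \<open>(y - y(t)) x'\<close>, a product of two
  functions with simple zeros at \<open>t\<close>. Hence it is strictly monotone near \<open>t\<close>, in the direction
  given by the sign of \<open>x'' y'\<close>.\<close>

lemma cusp_local:
  assumes "cusp \<gamma> t"
  shows "\<exists>e>0.
    (\<forall>r\<in>{t - e<..<t}. \<forall>s\<in>{t<..<t + e}. \<gamma> r $ 1 = \<gamma> s $ 1 \<longrightarrow>
        A t $ 1 * V t $ 2 * \<gamma> r $ 3 < A t $ 1 * V t $ 2 * \<gamma> s $ 3) \<and>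
    (\<forall>d. 0 < d \<and> d < e \<longrightarrow>
        (\<exists>r s. t - d \<le> r \<and> r < t \<and> t < s \<and> s \<le> t + d \<and> \<gamma> r $ 1 = \<gamma> s $ 1))"
proof -
  note nd = cusp_nondegenerate[OF assms]
  have V0: "V t $ 1 = 0" using assms cusp_iff by simp
  have "((\<lambda>s. \<gamma> s $ 2 - \<gamma> t $ 2) has_real_derivative V t $ 2) (at t)"
    by (auto intro!: derivative_eq_intros deriv_coord)
  from simple_zero_sign[OF this] simple_zero_sign[OF deriv_coord(2)[of 1 t] V0] nd
  have "\<forall>\<^sub>F s in at t. V t $ 2 * (s - t) * (\<gamma> s $ 2 - \<gamma> t $ 2) > 0 \<and>
      A t $ 1 * (s - t) * V s $ 1 > 0"
    by (auto intro: eventually_conj)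
  then obtain e where e: "e > 0" and near: "\<And>s. s \<noteq> t \<Longrightarrow> \<bar>s - t\<bar> < e \<Longrightarrow>
      V t $ 2 * (s - t) * (\<gamma> s $ 2 - \<gamma> t $ 2) > 0 \<and> A t $ 1 * (s - t) * V s $ 1 > 0"
    unfolding eventually_at dist_real_def by blast
  \<comment> \<open>The factor \<open>x''(t)\<close> turns \<open>t\<close> into a local minimum of
    \<open>X\<close> for left and right cusps alike; the factor in \<open>Z\<close> likewise makes
    \<open>Z\<close> increasing.\<close>
  define X where "X s = A t $ 1 * \<gamma> s $ 1" for s
  define Z where "Z s = A t $ 1 * V t $ 2 * (\<gamma> s $ 3 - \<gamma> t $ 2 * \<gamma> s $ 1)" for s
  have X': "(X has_real_derivative A t $ 1 * V s $ 1) (at s)" for s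
    unfolding X_def by (auto intro!: derivative_eq_intros deriv_coord)
  have Z': "(Z has_real_derivative A t $ 1 * V t $ 2 * ((\<gamma> s $ 2 - \<gamma> t $ 2) * V s $ 1)) (at s)" for s
    unfolding Z_def
    by (auto intro!: derivative_eq_intros deriv_coord simp: contact algebra_simps)
  have cont: "continuous_on S X" "continuous_on S Z" for S
    by (meson X' Z' DERIV_isCont continuous_at_imp_continuous_on)+
  have Z'_pos: "A t $ 1 * V t $ 2 * ((\<gamma> s $ 2 - \<gamma> t $ 2) * V s $ 1) > 0"
    if "s \<noteq> t" "\<bar>s - t\<bar> < e" for s
  proof -
    have "0 < (V t $ 2 * (s - t) * (\<gamma> s $ 2 - \<gamma> t $ 2)) * (A t $ 1 * (s - t) * V s $ 1)"
      using near[OF that] by (blast intro: mult_pos_pos)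
    also have "\<dots> = (A t $ 1 * V t $ 2 * ((\<gamma> s $ 2 - \<gamma> t $ 2) * V s $ 1)) * (s - t)\<^sup>2"
      by (simp add: power2_eq_square algebra_simps)
    finally show ?thesis using that by (simp add: zero_less_mult_iff)
  qed
  \<comment> \<open>Only the open interval must avoid \<open>t\<close>, so \<open>t\<close>, where
    the derivative of \<open>Z\<close> vanishes, may be an endpoint.\<close>
  have Z_mono: "Z r < Z s" if "r < s" "{r<..<s} \<subseteq> {t - e<..<t + e} - {t}" for r s
  proof (rule DERIV_pos_imp_increasing_open[where f = Z, OF that(1)])
    fix u assume "r < u" "u < s"
    then have "u \<in> {t - e<..<t + e} - {t}" using that(2) by auto
    then have "u \<noteq> t" "\<bar>u - t\<bar> < e" by auto
    then show "\<exists>y. (Z has_real_derivative y) (at u) \<and> y > 0" using Z' Z'_pos by blast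
  qed (rule cont)
  show ?thesis
  proof (rule exI[of _ e], intro conjI ballI allI impI)
    show "e > 0" by fact
  next
    fix r s assume r: "r \<in> {t - e<..<t}" and s: "s \<in> {t<..<t + e}" and eq: "\<gamma> r $ 1 = \<gamma> s $ 1"
    have "Z r < Z t" "Z t < Z s" using r s by (auto intro!: Z_mono)
    \<comment> \<open>Above the same \<open>x\<close> the correction term \<open>y(t) x\<close> in
      \<open>Z\<close> cancels.\<close>
    then show "A t $ 1 * V t $ 2 * \<gamma> r $ 3 < A t $ 1 * V t $ 2 * \<gamma> s $ 3"
      using eq by (simp add: Z_def algebra_simps)
  next
    \<comment> \<open>Comparable points are needed arbitrarily close to \<open>t\<close>, since
      otherwise the comparison of the branches could hold vacuously.\<close>
    fix d assume "0 < d \<and> d < e"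
    then have d: "0 < d" "d < e" by auto
    have "X t < X (t - d)"
    proof (rule DERIV_neg_imp_decreasing_open[where f = X])
      fix s assume s: "t - d < s" "s < t"
      then have "A t $ 1 * V s $ 1 * (s - t) > 0" using near[of s] d by (simp add: algebra_simps)
      then have "A t $ 1 * V s $ 1 < 0" using s by (simp add: zero_less_mult_iff)
      then show "\<exists>y. (X has_real_derivative y) (at s) \<and> y < 0" using X' by blast
    qed (use d cont in auto)
    moreover have "X t < X (t + d)"
    proof (rule DERIV_pos_imp_increasing_open[where f = X])
      fix s assume s: "t < s" "s < t + d"
      then have "A t $ 1 * V s $ 1 * (s - t) > 0" using near[of s] d by (simp add: algebra_simps)
      then have "A t $ 1 * V s $ 1 > 0" using s by (simp add: zero_less_mult_iff)
      then show "\<exists>y. (X has_real_derivative y) (at s) \<and> y > 0" using X' by blast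
    qed (use d cont in auto)
    ultimately show "\<exists>r s. t - d \<le> r \<and> r < t \<and> t < s \<and> s \<le> t + d \<and> \<gamma> r $ 1 = \<gamma> s $ 1"
      using strict_minimum_same_value[OF d(1) cont(1)[of "{t - d..t + d}"]] nd by (auto simp: X_def)
  qed
qed

text \<open>By \<open>cusp_local\<close> the sign of \<open>x'' y'\<close> decides which branch is
  the upper one. The two kinds of cusp exclude each other because every neighbourhood of the cusp
  contains points of both branches above the same \<open>x\<close>.\<close>

lemma up_cusp_iff: "up_cusp \<gamma> t \<longleftrightarrow> cusp \<gamma> t \<and> A t $ 1 * V t $ 2 > 0"
  and down_cusp_iff: "down_cusp \<gamma> t \<longleftrightarrow> cusp \<gamma> t \<and> A t $ 1 * V t $ 2 < 0"
proof -
  have "(up_cusp \<gamma> t \<longleftrightarrow> A t $ 1 * V t $ 2 > 0) \<and> (down_cusp \<gamma> t \<longleftrightarrow> A t $ 1 * V t $ 2 < 0)"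
    if cusp: "cusp \<gamma> t"
  proof -
    define k where "k = A t $ 1 * V t $ 2"
    have k: "k \<noteq> 0" using cusp_nondegenerate[OF cusp] by (simp add: k_def)
    obtain e where e: "e > 0"
      and lt: "\<And>r s. r \<in> {t - e<..<t} \<Longrightarrow> s \<in> {t<..<t + e} \<Longrightarrow> \<gamma> r $ 1 = \<gamma> s $ 1 \<Longrightarrow>
        k * \<gamma> r $ 3 < k * \<gamma> s $ 3"
      and ex: "\<And>d. 0 < d \<Longrightarrow> d < e \<Longrightarrow>
        \<exists>r s. t - d \<le> r \<and> r < t \<and> t < s \<and> s \<le> t + d \<and> \<gamma> r $ 1 = \<gamma> s $ 1"
      using cusp_local[OF cusp] unfolding k_def by blast
    have up: "up_cusp \<gamma> t" if "k > 0"
      unfolding up_cusp_def using cusp e lt mult_less_cancel_left_pos[OF that] by blast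
    have down: "down_cusp \<gamma> t" if "k < 0"
      unfolding down_cusp_def using cusp e lt mult_less_cancel_left_neg[OF that] by blast
    have "\<not> (up_cusp \<gamma> t \<and> down_cusp \<gamma> t)"
    proof
      assume "up_cusp \<gamma> t \<and> down_cusp \<gamma> t"
      then obtain e1 e2 where e1: "e1 > 0" "\<And>r s. r \<in> {t - e1<..<t} \<Longrightarrow> s \<in> {t<..<t + e1} \<Longrightarrow>
            \<gamma> r $ 1 = \<gamma> s $ 1 \<Longrightarrow> \<gamma> r $ 3 < \<gamma> s $ 3"
        and e2: "e2 > 0" "\<And>r s. r \<in> {t - e2<..<t} \<Longrightarrow> s \<in> {t<..<t + e2} \<Longrightarrow>
            \<gamma> r $ 1 = \<gamma> s $ 1 \<Longrightarrow> \<gamma> r $ 3 > \<gamma> s $ 3"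
        unfolding up_cusp_def down_cusp_def by blast
      \<comment> \<open>Halving keeps the closed bounds \<open>t - d\<close> and
        \<open>t + d\<close> strictly within all three neighbourhoods.\<close>
      define d where "d = min e (min e1 e2) / 2"
      have d: "0 < d" "d < e" "d < e1" "d < e2" using e e1 e2 by (auto simp: d_def min_def)
      from ex[OF d(1,2)] obtain r s
        where "t - d \<le> r" "r < t" "t < s" "s \<le> t + d" "\<gamma> r $ 1 = \<gamma> s $ 1" by blast
      then show False using e1(2)[of r s] e2(2)[of r s] d by auto
    qed
    then show ?thesis using up down k unfolding k_def[symmetric] by (metis linorder_neqE less_asym)
  qed
  then show "up_cusp \<gamma> t \<longleftrightarrow> cusp \<gamma> t \<and> A t $ 1 * V t $ 2 > 0"
    "down_cusp \<gamma> t \<longleftrightarrow> cusp \<gamma> t \<and> A t $ 1 * V t $ 2 < 0"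
    by (auto simp: up_cusp_def down_cusp_def)
qed

lemma cusp_up_or_down: "cusp \<gamma> t \<longleftrightarrow> up_cusp \<gamma> t \<or> down_cusp \<gamma> t"
  using cusp_nondegenerate[of t] linorder_neq_iff[of "A t $ 1 * V t $ 2" 0]
  by (auto simp: up_cusp_iff down_cusp_iff)

lemma not_up_and_down: "\<not> (up_cusp \<gamma> t \<and> down_cusp \<gamma> t)"
  by (auto simp: up_cusp_iff down_cusp_iff)

section \<open>Double points and crossings\<close>

lemma point_frac: "\<gamma> (frac t) = \<gamma> t"
  using period(2)[of t "- \<lfloor>t\<rfloor>"] by (simp add: frac_def)

lemma same_point_iff: "\<gamma> s = \<gamma> t \<longleftrightarrow> (\<exists>k::int. t = s + of_int k)"
proof
  assume eq: "\<gamma> s = \<gamma> t"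
  then have "\<gamma> (frac s) = \<gamma> (frac t)" by (simp add: point_frac)
  then have "frac s = frac t"
    using knot by (auto simp: legendrian_knot_def frac_lt_1 elim!: inj_onD)
  then have "t = s + of_int (\<lfloor>t\<rfloor> - \<lfloor>s\<rfloor>)" by (simp add: frac_def)
  then show "\<exists>k::int. t = s + of_int k" by blast
qed (use period in auto)

text \<open>The slope recovers the coordinate lost in the front, since \<open>y = dz/dx\<close>
  along a Legendrian curve.\<close>

lemma slope_eq: "V t $ 1 \<noteq> 0 \<Longrightarrow> slope \<gamma> t = \<gamma> t $ 2"
  by (simp add: slope_def front_velocity contact)

lemma double_point_sym: "double_point \<gamma> s t \<Longrightarrow> double_point \<gamma> t s"
  by (auto simp: double_point_def)

lemma double_point_transverse:
  assumes "double_point \<gamma> s t"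
  shows "det2 (velocity (front \<gamma>) s) (velocity (front \<gamma>) t) \<noteq> 0" "\<not> cusp \<gamma> s" "\<not> cusp \<gamma> t"
proof -
  show det: "det2 (velocity (front \<gamma>) s) (velocity (front \<gamma>) t) \<noteq> 0"
    using assms generic by (simp add: generic_front_def)
  show "\<not> cusp \<gamma> s" "\<not> cusp \<gamma> t"
    using det by (auto simp: cusp_def det2_def simp del: split_paired_All)
qed

lemma no_triple_point: "double_point \<gamma> r s \<Longrightarrow> double_point \<gamma> s t \<Longrightarrow> \<gamma> r = \<gamma> t"
  using generic unfolding generic_front_def by (metis double_point_def)

lemma crossing_over_unique: "crossing \<gamma> p q \<Longrightarrow> crossing \<gamma> p' q \<Longrightarrow> \<gamma> p = \<gamma> p'"
  using no_triple_point double_point_sym by (metis crossing_def)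

text \<open>If \<open>r\<close> passed over \<open>p\<close> and \<open>p\<close> over
  \<open>q\<close>, the absence of triple points would give \<open>\<gamma> r = \<gamma> q\<close>
  and hence equal slopes, as the slope is \<open>y\<close>. Together with
  \<open>double_point_transverse\<close> this places every overpass in the interior of an
  arc.\<close>

lemma crossing_over_not_under:
  assumes "crossing \<gamma> p q" shows "\<not> crossing \<gamma> r p"
proof
  assume "crossing \<gamma> r p"
  with assms have d: "double_point \<gamma> r p" "double_point \<gamma> p q" and lt: "slope \<gamma> r < slope \<gamma> q"
    by (auto simp: crossing_def)
  have "slope \<gamma> r = \<gamma> r $ 2" "slope \<gamma> q = \<gamma> q $ 2"
    using double_point_transverse(2)[OF d(1)] double_point_transverse(3)[OF d(2)]
    by (simp_all add: slope_eq cusp_iff)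
  with lt no_triple_point[OF d] show False by simp
qed

lemma crossing_period:
  "crossing \<gamma> (p + 1) q \<longleftrightarrow> crossing \<gamma> p q" "crossing \<gamma> p (q + 1) \<longleftrightarrow> crossing \<gamma> p q"
  "crossing_sign \<gamma> (p + 1) q = crossing_sign \<gamma> p q"
  "crossing_sign \<gamma> p (q + 1) = crossing_sign \<gamma> p q"
  by (simp_all add: crossing_def crossing_sign_def double_point_def slope_def front_velocity
      front_period period V_period)

lemma crossing_period_over:
  assumes "\<gamma> p = \<gamma> p'"
  shows "crossing \<gamma> p q \<longleftrightarrow> crossing \<gamma> p' q" "crossing_sign \<gamma> p q = crossing_sign \<gamma> p' q"
proof -
  obtain k where "p' = p + of_int k" using assms same_point_iff by blast
  then show "crossing \<gamma> p q \<longleftrightarrow> crossing \<gamma> p' q" "crossing_sign \<gamma> p q = crossing_sign \<gamma> p' q"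
    using periodic_of_int[of "\<lambda>p. crossing \<gamma> p q", OF crossing_period(1), of p k]
      periodic_of_int[of "\<lambda>p. crossing_sign \<gamma> p q", OF crossing_period(3), of p k] by simp_all
qed

text \<open>The overcrossing point is determined by the underpass, so the sign of a crossing may be
  attached to the parameter \<open>t\<close> of the underpass alone.\<close>

definition pos_under :: "real \<Rightarrow> bool" where
  "pos_under t \<longleftrightarrow> (\<exists>p. crossing \<gamma> p t \<and> crossing_sign \<gamma> p t > 0)"

definition neg_under :: "real \<Rightarrow> bool" where
  "neg_under t \<longleftrightarrow> (\<exists>p. crossing \<gamma> p t \<and> crossing_sign \<gamma> p t < 0)"

lemma crossing_pos_iff: "crossing \<gamma> p t \<Longrightarrow> crossing_sign \<gamma> p t > 0 \<longleftrightarrow> pos_under t"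
  and crossing_neg_iff: "crossing \<gamma> p t \<Longrightarrow> crossing_sign \<gamma> p t < 0 \<longleftrightarrow> neg_under t"
proof -
  assume p: "crossing \<gamma> p t"
  define \<sigma> where "\<sigma> = crossing_sign \<gamma> p t"
  have "crossing_sign \<gamma> p' t = \<sigma>" if "crossing \<gamma> p' t" for p'
    unfolding \<sigma>_def using crossing_over_unique[OF that p] by (rule crossing_period_over(2))
  then have "\<sigma> > 0 \<longleftrightarrow> pos_under t" "\<sigma> < 0 \<longleftrightarrow> neg_under t"
    unfolding pos_under_def neg_under_def using p by auto
  then show "crossing_sign \<gamma> p t > 0 \<longleftrightarrow> pos_under t" "crossing_sign \<gamma> p t < 0 \<longleftrightarrow> neg_under t"
    unfolding \<sigma>_def .
qed

lemma crossing_sign_nonzero: "crossing \<gamma> p t \<Longrightarrow> crossing_sign \<gamma> p t \<noteq> 0"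
  using double_point_transverse(1) by (auto simp: crossing_def crossing_sign_def sgn_zero_iff)

lemma under_iff: "(\<exists>p. crossing \<gamma> p t) \<longleftrightarrow> pos_under t \<or> neg_under t"
  unfolding pos_under_def neg_under_def using crossing_sign_nonzero linorder_neqE by metis

lemma not_pos_and_neg: "\<not> (pos_under t \<and> neg_under t)"
  using crossing_pos_iff unfolding neg_under_def by force

lemma not_cusp_and_under: "cusp \<gamma> t \<Longrightarrow> \<not> pos_under t" "cusp \<gamma> t \<Longrightarrow> \<not> neg_under t"
  using double_point_transverse(3) by (auto simp: pos_under_def neg_under_def crossing_def)

section \<open>Break points\<close>

lemma break_point_iff:
  "break_point \<gamma> t \<longleftrightarrow> up_cusp \<gamma> t \<or> down_cusp \<gamma> t \<or> pos_under t \<or> neg_under t"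
  unfolding break_point_def cusp_up_or_down under_iff by blast

lemma cusp_period: "up_cusp \<gamma> (t + 1) = up_cusp \<gamma> t" "down_cusp \<gamma> (t + 1) = down_cusp \<gamma> t"
  by (simp_all add: up_cusp_iff down_cusp_iff cusp_iff V_period A_period)

lemma under_period: "pos_under (t + 1) = pos_under t" "neg_under (t + 1) = neg_under t"
  by (simp_all add: pos_under_def neg_under_def crossing_period)

text \<open>Rolle's theorem for the periodic coordinate \<open>x\<close>. Thus there are always
  break points, and hence arcs.\<close>

lemma ex_cusp: "\<exists>t. cusp \<gamma> t"
proof -
  have "\<exists>z. 0 < z \<and> z < 1 \<and> (*) (V z $ 1) = (\<lambda>v. 0)"
  proof (rule Rolle_deriv[of 0 1 "\<lambda>t. \<gamma> t $ 1"])
    show "\<gamma> 0 $ 1 = \<gamma> 1 $ 1" using period(1)[of 0] by simp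
    show "continuous_on {0..1} (\<lambda>t. \<gamma> t $ 1)"
      by (rule DERIV_continuous_on[OF has_field_derivative_at_within[OF deriv_coord(1)]])
    show "((\<lambda>t. \<gamma> t $ 1) has_derivative (*) (V z $ 1)) (at z)" for z
      using deriv_coord(1)[of 1 z] unfolding has_field_derivative_def .
  qed simp
  then obtain z where "(*) (V z $ 1) = (\<lambda>v. 0)" by blast
  from fun_cong[OF this, of 1] have "cusp \<gamma> z" by (simp add: cusp_iff)
  then show ?thesis ..
qed

lemma crossing_frac: "crossing \<gamma> p t \<Longrightarrow> crossing \<gamma> (frac p) t"
  by (rule iffD2[OF crossing_period_over(1)[OF point_frac]])

sublocale breaks: periodic_points "Collect (break_point \<gamma>)"
proof
  show "Collect (break_point \<gamma>) \<noteq> {}" using ex_cusp unfolding break_point_def by blast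
  show "t + 1 \<in> Collect (break_point \<gamma>) \<longleftrightarrow> t \<in> Collect (break_point \<gamma>)" for t
    by (simp add: break_point_iff cusp_period under_period)
  \<comment> \<open>The overpass \<open>p\<close> may lie outside the period, so it is replaced by
    its fractional part.\<close>
  have "t \<in> snd ` {(s, t). s \<in> {0..<1} \<and> t \<in> {0..<1} \<and> double_point \<gamma> s t}"
    if "crossing \<gamma> p t" "t \<in> {0..<1}" for p t
    using crossing_frac[OF that(1)] that(2) frac_lt_1[of p]
    by (intro image_eqI[of _ _ "(frac p, t)"]) (simp_all add: crossing_def)
  then have "Collect (break_point \<gamma>) \<inter> {0..<1} \<subseteq> {t\<in>{0..<1}. cusp \<gamma> t} \<union>
      snd ` {(s, t). s \<in> {0..<1} \<and> t \<in> {0..<1} \<and> double_point \<gamma> s t}"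
    unfolding break_point_def by blast
  then show "finite (Collect (break_point \<gamma>) \<inter> {0..<1})"
    by (rule finite_subset) (use generic in \<open>simp add: generic_front_def\<close>)
qed

lemma consecutive_iff_gap: "consecutive \<gamma> a b \<longleftrightarrow> breaks.gap a b"
  by (auto simp: consecutive_def breaks.gap_def)

section \<open>Counting break points by type\<close>

definition n_pos :: nat where "n_pos = card {t\<in>{0..<1}. pos_under t}"
definition n_neg :: nat where "n_neg = card {t\<in>{0..<1}. neg_under t}"

lemma finite_breaks:
  "finite {t\<in>{0..<1}. up_cusp \<gamma> t}" "finite {t\<in>{0..<1}. down_cusp \<gamma> t}"
  "finite {t\<in>{0..<1}. pos_under t}" "finite {t\<in>{0..<1}. neg_under t}"
  by (rule finite_subset[OF _ breaks.finite_period]; force simp: break_point_iff)+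

text \<open>A crossing within the period is determined by its underpass, so the sum over pairs can
  be reindexed along \<open>snd\<close>.\<close>

lemma writhe_eq: "writhe \<gamma> = real n_pos - real n_neg"
proof -
  let ?C = "{(p, q). p \<in> {0..<1} \<and> q \<in> {0..<1} \<and> crossing \<gamma> p q}"
  let ?P = "{t\<in>{0..<1}. pos_under t}" and ?N = "{t\<in>{0..<1}. neg_under t}"
  have inj: "inj_on snd ?C"
  proof (rule inj_onI)
    fix c c' assume "c \<in> ?C" "c' \<in> ?C" "snd c = snd c'"
    then obtain p p' q where c: "c = (p, q)" "c' = (p', q)" "p \<in> {0..<1}" "p' \<in> {0..<1}"
      "crossing \<gamma> p q" "crossing \<gamma> p' q"
      by (cases c; cases c'; simp)
    have "\<gamma> p = \<gamma> p'" using crossing_over_unique c(5,6) .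
    moreover have "inj_on \<gamma> {0..<1}" using knot by (simp add: legendrian_knot_def)
    ultimately show "c = c'" using c(1-4) by (simp add: inj_on_eq_iff)
  qed
  have img: "snd ` ?C = ?P \<union> ?N"
  proof
    show "snd ` ?C \<subseteq> ?P \<union> ?N"
    proof
      fix t assume "t \<in> snd ` ?C"
      then obtain p where "crossing \<gamma> p t" "t \<in> {0..<1}" by force
      then show "t \<in> ?P \<union> ?N" using under_iff by blast
    qed
    show "?P \<union> ?N \<subseteq> snd ` ?C"
    proof
      fix t assume "t \<in> ?P \<union> ?N"
      then obtain p where "crossing \<gamma> p t" "t \<in> {0..<1}" using under_iff by blast
      then show "t \<in> snd ` ?C"
        using crossing_frac[of p t] frac_lt_1[of p]
        by (intro image_eqI[of _ _ "(frac p, t)"]) simp_all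
    qed
  qed
  have sign: "crossing_sign \<gamma> p q = (if pos_under q then 1 else -1)" if "crossing \<gamma> p q" for p q
    using crossing_pos_iff[OF that] crossing_sign_nonzero[OF that]
    by (auto simp: crossing_sign_def sgn_if split: if_splits)
  have "writhe \<gamma> = (\<Sum>c\<in>?C. if pos_under (snd c) then 1 else -1)"
    unfolding writhe_def by (rule sum.cong) (auto simp: sign)
  also have "\<dots> = (\<Sum>t\<in>?P \<union> ?N. if pos_under t then 1 else -1)"
    unfolding img[symmetric] by (simp only: sum.reindex[OF inj] o_def)
  also have "\<dots> = (\<Sum>t\<in>?P. if pos_under t then 1 else -1) + (\<Sum>t\<in>?N. if pos_under t then 1 else -1)"
    using finite_breaks not_pos_and_neg by (intro sum.union_disjoint) auto
  also have "(\<Sum>t\<in>?P. if pos_under t then 1 else -1 :: real) = (\<Sum>t\<in>?P. 1)"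
    by (rule sum.cong) auto
  also have "(\<Sum>t\<in>?N. if pos_under t then 1 else -1 :: real) = (\<Sum>t\<in>?N. -1)"
    using not_pos_and_neg by (intro sum.cong) auto
  finally show ?thesis by (simp add: n_pos_def n_neg_def)
qed

text \<open>The shift of a weighting when the knot passes \<open>t\<close>. The last branch is meant
  for negative underpasses and doubles as a default away from break points, where neither the sum
  over a period nor a gap condition evaluates it.\<close>

definition break_weight :: "int \<Rightarrow> int \<Rightarrow> real \<Rightarrow> int" where
  "break_weight \<alpha> \<beta> t =
     (if up_cusp \<gamma> t then \<alpha> else if down_cusp \<gamma> t then - \<alpha> - \<beta> else if pos_under t then \<beta> else - \<beta>)"

lemma break_weight_simps:
  "up_cusp \<gamma> t \<Longrightarrow> break_weight \<alpha> \<beta> t = \<alpha>"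
  "down_cusp \<gamma> t \<Longrightarrow> break_weight \<alpha> \<beta> t = - \<alpha> - \<beta>"
  "pos_under t \<Longrightarrow> break_weight \<alpha> \<beta> t = \<beta>"
  "neg_under t \<Longrightarrow> break_weight \<alpha> \<beta> t = - \<beta>"
  using not_up_and_down[of t] not_pos_and_neg[of t] not_cusp_and_under[of t] cusp_up_or_down[of t]
  by (auto simp: break_weight_def)

lemma sum_break_weight:
  "(\<Sum>t\<in>Collect (break_point \<gamma>) \<inter> {0..<1}. break_weight \<alpha> \<beta> t) =
     \<alpha> * (int (n_up \<gamma>) - int (n_down \<gamma>)) + \<beta> * (int n_pos - int n_neg - int (n_down \<gamma>))"
proof -
  let ?U = "{t\<in>{0..<1}. up_cusp \<gamma> t}" and ?D = "{t\<in>{0..<1}. down_cusp \<gamma> t}"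
  let ?P = "{t\<in>{0..<1}. pos_under t}" and ?N = "{t\<in>{0..<1}. neg_under t}"
  have "Collect (break_point \<gamma>) \<inter> {0..<1} = (?U \<union> ?D) \<union> (?P \<union> ?N)"
    by (auto simp: break_point_iff)
  moreover have "?U \<inter> ?D = {}" "?P \<inter> ?N = {}" "(?U \<union> ?D) \<inter> (?P \<union> ?N) = {}"
    using not_up_and_down not_pos_and_neg not_cusp_and_under cusp_up_or_down by blast+
  ultimately have "(\<Sum>t\<in>Collect (break_point \<gamma>) \<inter> {0..<1}. break_weight \<alpha> \<beta> t) =
      (\<Sum>t\<in>?U. break_weight \<alpha> \<beta> t) + (\<Sum>t\<in>?D. break_weight \<alpha> \<beta> t) +
      ((\<Sum>t\<in>?P. break_weight \<alpha> \<beta> t) + (\<Sum>t\<in>?N. break_weight \<alpha> \<beta> t))"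
    using finite_breaks by (simp add: sum.union_disjoint)
  also have "\<dots> = (\<Sum>t\<in>?U. \<alpha>) + (\<Sum>t\<in>?D. - \<alpha> - \<beta>) + ((\<Sum>t\<in>?P. \<beta>) + (\<Sum>t\<in>?N. - \<beta>))"
    by (intro arg_cong2[of _ _ _ _ "(+)"] sum.cong) (auto simp: break_weight_simps)
  finally show ?thesis
    by (simp add: n_up_def n_down_def n_pos_def n_neg_def algebra_simps)
qed

section \<open>Arcs and the fundamental GL-rack\<close>

lemma arc_between_eq_imp_shift:
  assumes "consecutive \<gamma> a b" "consecutive \<gamma> a' b'" "arc_between \<gamma> a b = arc_between \<gamma> a' b'"
  shows "\<exists>k::int. a' = a + of_int k"
proof -
  \<comment> \<open>The midpoint serves as an interior point. Some parameter of the other arc gives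
    the same point of the knot, and translating the first gap by their integer difference makes the
    gaps overlap.\<close>
  have "(a + b) / 2 \<in> {a<..<b}" using assms(1) by (simp add: consecutive_def)
  then have "\<gamma> ((a + b) / 2) \<in> arc_between \<gamma> a' b'"
    using assms(3) unfolding arc_between_def by blast
  then obtain s where s: "s \<in> {a'<..<b'}" "\<gamma> ((a + b) / 2) = \<gamma> s"
    by (auto simp: arc_between_def)
  then obtain k :: int where k: "s = (a + b) / 2 + of_int k" using same_point_iff by blast
  have "breaks.gap (a + of_int k) (b + of_int k)"
    using assms(1) by (simp add: consecutive_iff_gap breaks.gap_shift)
  from breaks.gap_unique(1)[OF this, of a' b' s] have "a' = a + of_int k"
    using assms k s \<open>(a + b) / 2 \<in> {a<..<b}\<close> by (simp add: consecutive_iff_gap)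
  then show ?thesis by blast
qed

lemma arc_between_period: "arc_between \<gamma> (a + 1) (b + 1) = arc_between \<gamma> a b"
proof -
  have "t \<in> (\<lambda>t. t + 1) ` {a<..<b}" if "t \<in> {a + 1<..<b + 1}" for t
    using that by (intro image_eqI[of _ _ "t - 1"]) auto
  then have "{a + 1<..<b + 1} = (\<lambda>t. t + 1) ` {a<..<b}" by auto
  then show ?thesis by (simp add: arc_between_def image_image period)
qed

text \<open>Labels of arcs correspond to periodic potentials on the break points: \<open>P t\<close>
  is the label of the arc leaving \<open>t\<close>. The relation at \<open>t\<close> then says that
  \<open>P\<close> grows by \<open>break_weight\<close> from the previous break point, so
  \<open>potential_exists_iff\<close> applies.\<close>

lemma GLR_weighting_iff:
  "(\<exists>f. gl_weighting n \<alpha> \<beta> (GLR \<gamma>) f) \<longleftrightarrow>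
   n dvd \<alpha> * (int (n_up \<gamma>) - int (n_down \<gamma>)) + \<beta> * (int n_pos - int n_neg - int (n_down \<gamma>))"
proof -
  let ?R = "cusp_relations \<gamma> \<union> crossing_relations \<gamma>"
  let ?arc = "arc_between \<gamma>" and ?w = "term_weight \<alpha> \<beta>"
  have arcs: "?arc a b \<in> arcs \<gamma>" if "consecutive \<gamma> a b" for a b
    using that by (auto simp: arcs_def)
  have "(\<exists>g. \<forall>(s, t)\<in>?R. s \<in> terms_over (arcs \<gamma>) \<longrightarrow> t \<in> terms_over (arcs \<gamma>) \<longrightarrow>
        [?w g s = ?w g t] (mod n)) \<longleftrightarrow>
    (\<exists>P. (\<forall>t\<in>Collect (break_point \<gamma>). P (t + 1) = P t) \<and>
      (\<forall>a b. breaks.gap a b \<longrightarrow> [P b = P a + break_weight \<alpha> \<beta> b] (mod n)))"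
    (is "?lhs \<longleftrightarrow> ?rhs")
  proof
    assume ?lhs
    then obtain g where g: "\<And>s t. (s, t) \<in> ?R \<Longrightarrow> s \<in> terms_over (arcs \<gamma>) \<Longrightarrow>
      t \<in> terms_over (arcs \<gamma>) \<Longrightarrow> [?w g s = ?w g t] (mod n)" by blast
    define nxt where "nxt t = (SOME b. consecutive \<gamma> t b)" for t
    define P where "P t = g (?arc t (nxt t))" for t
    have nxt: "nxt a = b" if "consecutive \<gamma> a b" for a b
    proof -
      have "consecutive \<gamma> a (nxt a)" using that unfolding nxt_def by (rule someI)
      then show ?thesis using that by (force simp: consecutive_def)
    qed
    have ex: "\<exists>b. consecutive \<gamma> t b" if "break_point \<gamma> t" for t
      using breaks.ex_next[of t] that by (auto simp: consecutive_def)
    have "P (t + 1) = P t" if t: "break_point \<gamma> t" for t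
    proof -
      obtain b where b: "consecutive \<gamma> t b" using ex[OF t] by blast
      then have "consecutive \<gamma> (t + 1) (b + 1)"
        using breaks.gap_shift[of t b 1] by (simp add: consecutive_iff_gap)
      from nxt[OF this] nxt[OF b] show ?thesis by (simp add: P_def arc_between_period)
    qed
    moreover have "[P t = P a + break_weight \<alpha> \<beta> t] (mod n)" if at: "consecutive \<gamma> a t" for a t
    proof -
      have t: "break_point \<gamma> t" using at by (simp add: consecutive_def)
      obtain b where tb: "consecutive \<gamma> t b" using ex[OF t] by blast
      have P: "P a = g (?arc a t)" "P t = g (?arc t b)" by (simp_all add: P_def nxt[OF at] nxt[OF tb])
      note in_arcs = arcs[OF at] arcs[OF tb]
      have rel: ?thesis if "(Gen (?arc t b), s) \<in> ?R" "s \<in> terms_over (arcs \<gamma>)"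
        "?w g s = g (?arc a t) + break_weight \<alpha> \<beta> t" for s
        using g[OF that(1)] that(2,3) in_arcs P by simp
      consider "up_cusp \<gamma> t" | "down_cusp \<gamma> t" | p where "crossing \<gamma> p t"
        using t by (auto simp: break_point_iff simp flip: under_iff)
      then show ?thesis
      proof cases
        case 1
        then show ?thesis using at tb in_arcs
          by (intro rel[of "Up (Gen (?arc a t))"]) (auto simp: cusp_relations_def break_weight_simps)
      next
        case 2
        then show ?thesis using at tb in_arcs
          by (intro rel[of "Down (Gen (?arc a t))"]) (auto simp: cusp_relations_def break_weight_simps)
      next
        case 3
        \<comment> \<open>Not being a break point, the overpass lies inside an arc from
          \<open>c\<close> to \<open>d\<close>, which the relation of the crossing takes as its
          overcrossing arc.\<close>
        have p_not: "\<not> break_point \<gamma> p"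
          using 3 crossing_over_not_under double_point_transverse(2)
          by (auto simp: break_point_def crossing_def)
        obtain c where c: "break_point \<gamma> c" "c < p" "{c<..<p} \<inter> Collect (break_point \<gamma>) = {}"
          using breaks.ex_prev[of p] by blast
        obtain d where d: "break_point \<gamma> d" "p < d" "{p<..<d} \<inter> Collect (break_point \<gamma>) = {}"
          using breaks.ex_next[of p] by blast
        have "\<not> break_point \<gamma> t'" if "t' \<in> {c<..<d}" for t'
        proof -
          have "t' \<in> {c<..<p} \<or> t' = p \<or> t' \<in> {p<..<d}" using that by auto
          then show ?thesis using p_not c(3) d(3) by blast
        qed
        then have cd: "consecutive \<gamma> c d"
          unfolding consecutive_def using c d by auto
        have p: "p \<in> {c<..<d}" using c d by simp
        show ?thesis
        proof (cases "crossing_sign \<gamma> p t > 0")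
          case True
          then have "(Gen (?arc t b), Mul (Gen (?arc a t)) (Gen (?arc c d))) \<in> ?R"
            using at tb cd p 3 unfolding crossing_relations_def by blast
          then show ?thesis
            using True 3 in_arcs arcs[OF cd] crossing_pos_iff
            by (intro rel) (auto simp: break_weight_simps)
        next
          case False
          then have neg: "crossing_sign \<gamma> p t < 0" using crossing_sign_nonzero[OF 3] by simp
          then have "(Gen (?arc t b), Div (Gen (?arc a t)) (Gen (?arc c d))) \<in> ?R"
            using at tb cd p 3 unfolding crossing_relations_def by blast
          then show ?thesis
            using neg 3 in_arcs arcs[OF cd] crossing_neg_iff
            by (intro rel) (auto simp: break_weight_simps)
        qed
      qed
    qed
    ultimately show ?rhs unfolding consecutive_iff_gap by blast
  next
    assume ?rhs
    then obtain P where P1: "\<And>t. break_point \<gamma> t \<Longrightarrow> P (t + 1) = P t"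
      and P2: "\<And>a b. consecutive \<gamma> a b \<Longrightarrow> [P b = P a + break_weight \<alpha> \<beta> b] (mod n)"
      unfolding consecutive_iff_gap by blast
    \<comment> \<open>\<open>P\<close> is known to be periodic only at break points; extending it by
      0 elsewhere allows arbitrary integer shifts.\<close>
    have "(if break_point \<gamma> (t + 1) then P (t + 1) else 0) = (if break_point \<gamma> t then P t else 0)" for t
      using P1 breaks.periodic by simp
    note P_shift = periodic_of_int[of "\<lambda>t. if break_point \<gamma> t then P t else 0", OF this]
    \<comment> \<open>An arc is a point set with many starting parameters. They differ by integers,
      so the periodicity of \<open>P\<close> makes the choice harmless.\<close>
    define g where "g A = P (SOME a. \<exists>b. consecutive \<gamma> a b \<and> A = ?arc a b)" for A
    have g: "g (?arc a b) = P a" if ab: "consecutive \<gamma> a b" for a b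
    proof -
      define a' where "a' = (SOME a'. \<exists>b'. consecutive \<gamma> a' b' \<and> ?arc a b = ?arc a' b')"
      have "\<exists>b'. consecutive \<gamma> a' b' \<and> ?arc a b = ?arc a' b'"
        unfolding a'_def by (rule someI) (use ab in blast)
      then obtain b' where b': "consecutive \<gamma> a' b'" "?arc a b = ?arc a' b'" by blast
      obtain k :: int where "a' = a + of_int k"
        using arc_between_eq_imp_shift[OF ab b'] by blast
      moreover have "break_point \<gamma> a'" using b'(1) by (simp add: consecutive_def)
      moreover have "break_point \<gamma> a" using ab by (simp add: consecutive_def)
      ultimately show ?thesis using P_shift[of a k] by (simp add: g_def a'_def)
    qed
    have P_step: "up_cusp \<gamma> b \<Longrightarrow> [P b = P a + \<alpha>] (mod n)"
      "down_cusp \<gamma> b \<Longrightarrow> [P b = P a - \<alpha> - \<beta>] (mod n)"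
      "pos_under b \<Longrightarrow> [P b = P a + \<beta>] (mod n)"
      "neg_under b \<Longrightarrow> [P b = P a - \<beta>] (mod n)" if "consecutive \<gamma> a b" for a b
      using P2[OF that] by (simp_all add: break_weight_simps algebra_simps)
    have "[?w g s = ?w g t] (mod n)" if "(s, t) \<in> ?R" for s t
      using that
      by (auto simp: cusp_relations_def crossing_relations_def g crossing_pos_iff crossing_neg_iff
          intro: P_step)
    then show ?lhs by blast
  qed
  also have "?rhs \<longleftrightarrow>
      n dvd (\<Sum>t\<in>Collect (break_point \<gamma>) \<inter> {0..<1}. break_weight \<alpha> \<beta> t)"
    by (rule breaks.potential_exists_iff)
      (simp add: break_weight_def cusp_period under_period)
  finally show ?thesis
    unfolding GLR_def presented_glrack_weighting_iff sum_break_weight .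
qed

end

section \<open>The invariants up to a common sign\<close>

lemma generic_knot_front_diagram:
  assumes "front_diagram_of K \<gamma>"
  shows "generic_knot \<gamma>"
proof
  obtain H :: "real \<times> real \<Rightarrow> real^3"
    where "\<forall>s\<in>{0..1}. legendrian_knot (\<lambda>t. H (s, t))" "\<forall>t. H (1, t) = \<gamma> t"
    using assms by (auto simp: front_diagram_of_def legendrian_isotopic_def)
  then show "legendrian_knot \<gamma>" by (force dest: bspec[of _ _ 1])
  show "generic_front \<gamma>" using assms by (simp add: front_diagram_of_def)
qed

text \<open>Taking \<open>n\<close> to be either value yields mutual divisibility, so the two linear
  forms agree up to sign at every argument. The arguments \<open>(1, 0)\<close> and
  \<open>(0, 1)\<close> compare coefficients, and \<open>(1, 1)\<close> forces the two signs to
  agree.\<close>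

lemma linear_dvd_iff_imp_eq_up_to_sign:
  fixes p q p' q' :: int
  assumes "\<And>n \<alpha> \<beta>. n dvd \<alpha> * p + \<beta> * q \<longleftrightarrow> n dvd \<alpha> * p' + \<beta> * q'"
  shows "(p = p' \<and> q = q') \<or> (p = - p' \<and> q = - q')"
proof -
  have "\<bar>\<alpha> * p + \<beta> * q\<bar> = \<bar>\<alpha> * p' + \<beta> * q'\<bar>" for \<alpha> \<beta>
    using assms[of "\<alpha> * p + \<beta> * q" \<alpha> \<beta>] assms[of "\<alpha> * p' + \<beta> * q'" \<alpha> \<beta>]
    by (intro zdvd_antisym_abs) simp_all
  from this[of 1 0] this[of 0 1] this[of 1 1] show ?thesis by (auto simp: abs_if split: if_splits)
qed

theorem theorem1p1:
  fixes K1 K2 \<gamma>1 \<gamma>2 :: "real \<Rightarrow> real^3"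
  assumes "legendrian_knot K1" and "legendrian_knot K2"
    and "front_diagram_of K1 \<gamma>1" and "front_diagram_of K2 \<gamma>2"
    and "glrack_isomorphic (GLR \<gamma>1) (GLR \<gamma>2)"
  shows "(tb \<gamma>1 = tb \<gamma>2 \<and> rot \<gamma>1 = rot \<gamma>2) \<or> (tb \<gamma>1 = - tb \<gamma>2 \<and> rot \<gamma>1 = - rot \<gamma>2)"
proof -
  interpret k1: generic_knot \<gamma>1 using assms(3) by (rule generic_knot_front_diagram)
  interpret k2: generic_knot \<gamma>2 using assms(4) by (rule generic_knot_front_diagram)
  define p1 where "p1 = int (n_up \<gamma>1) - int (n_down \<gamma>1)"
  define p2 where "p2 = int (n_up \<gamma>2) - int (n_down \<gamma>2)"
  define q1 where "q1 = int k1.n_pos - int k1.n_neg - int (n_down \<gamma>1)"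
  define q2 where "q2 = int k2.n_pos - int k2.n_neg - int (n_down \<gamma>2)"
  have "n dvd \<alpha> * p1 + \<beta> * q1 \<longleftrightarrow> n dvd \<alpha> * p2 + \<beta> * q2" for n \<alpha> \<beta>
    using glrack_isomorphic_weighting_iff[OF assms(5), of n \<alpha> \<beta>]
    by (simp add: k1.GLR_weighting_iff k2.GLR_weighting_iff p1_def p2_def q1_def q2_def)
  then have "(p1 = p2 \<and> q1 = q2) \<or> (p1 = - p2 \<and> q1 = - q2)"
    by (rule linear_dvd_iff_imp_eq_up_to_sign)
  \<comment> \<open>Here \<open>(p, q) = (- 2 rot, tb - rot)\<close>, so \<open>rot\<close> and
    \<open>tb\<close> are linear in \<open>p\<close> and \<open>q\<close> and inherit the common
    sign.\<close>
  moreover have "rot \<gamma>1 = - p1 / 2" "tb \<gamma>1 = q1 - p1 / 2"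
    by (simp_all add: rot_def tb_def k1.writhe_eq p1_def q1_def field_simps)
  moreover have "rot \<gamma>2 = - p2 / 2" "tb \<gamma>2 = q2 - p2 / 2"
    by (simp_all add: rot_def tb_def k2.writhe_eq p2_def q2_def field_simps)
  ultimately show ?thesis by auto
qed

end
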